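(* Let $\alpha\in(0,1)$. In the sparse one-sided Gaussian location model $\mathbf P^{(m)}_{b,c,\beta}$ (with $b>0$, $c\in(0,1)$, $\beta\in[0,1)$), the number of rejections $\hat k_\alpha$ of the Benjamini–Hochberg procedure at level $\alpha$ is such that, as $m$ grows to infinity, $$\mathbf P^{(m)}_{b,c,\beta}\bigl(t^*_m\le\alpha\hat k_\alpha/m\le t^\sharp_m\bigr)\ge1-2e^{-d m_1},\qquad\text{for } m_1/m\lesssim t^*_m\le t^\sharp_m\lesssim m_1/m,$$ for some constant $d>0$ (depending on $\alpha,\beta,b$), where $t^*_m\in(0,1)$ is the unique solution of $G_m(t)=2t/\alpha$, $t^\sharp_m\in(0,1)$ is the unique solution of $G_m(t)=0.5\,t/\alpha$, and where $G_m(t)=(m_0/m)\,t+(m_1/m)\,\overline\Phi(\overline\Phi^{-1}(t)-\mu_m)$, with $\overline\Phi(z)=\mathbf P(Z\ge z)$, $z\in\mathbb R$, for $Z\sim\mathcal N(0,1)$.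
   Context: Model $\mathbf P^{(m)}_{b,c,\beta}$: $p_i=\overline\Phi(X_i)$, $1\le i\le m$; the $X_i$ are independent, $X_i\sim\mathcal N(0,1)$ for $i\in\mathcal H_0$ and $X_i\sim\mathcal N(\mu_m,1)$ for $i\in\mathcal H_1=\{1,\dots,m\}\setminus\mathcal H_0$, with $\mu_m=\sqrt{2\beta\log m}+b$, $m_1=|\mathcal H_1|=\lfloor cm^{1-\beta}\rfloor$ and $m_0=|\mathcal H_0|=m-m_1$. With ordered $p$-values $p_{(1)}\le\dots\le p_{(m)}$, $\hat k_\alpha=\max\{k: mp_{(k)}/k\le\alpha\}$ ($=0$ if there is no such $k\in\{1,\dots,m\}$). $u_m\lesssim v_m$ means $u_m\le Cv_m$ for $m$ large enough, for some constant $C>0$ not depending on $m$.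
   Formalization: Claims about t♯ are made for α<1/2 only, since for α≥1/2 the equation G_m(t)=0.5t/α has no solution in (0,1) once m_1≥1 (the t* part is kept for all α in (0,1)); for β=0 the constant d may also depend on c, since a choice uniform in c is impossible. *)

theory Defs
  imports "HOL-Probability.Probability"
begin

definition lesssim :: "(nat \<Rightarrow> real) \<Rightarrow> (nat \<Rightarrow> real) \<Rightarrow> bool" where
  "lesssim u v \<longleftrightarrow> (\<exists>C>0. \<forall>\<^sub>F m in sequentially. u m \<le> C * v m)"

definition Phi_bar :: "real \<Rightarrow> real" where
  "Phi_bar z = measure std_normal_distribution {z..}"

text \<open>
  \<open>Phi_bar\<close> is a bijection of the real line onto the open unit interval, so
  \<open>inv Phi_bar t\<close> is meaningful for \<open>0 < t < 1\<close> only.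
\<close>

definition mu :: "real \<Rightarrow> real \<Rightarrow> nat \<Rightarrow> real" where
  "mu b \<beta> m = sqrt (2 * \<beta> * ln (real m)) + b"

definition m1 :: "real \<Rightarrow> real \<Rightarrow> nat \<Rightarrow> nat" where
  "m1 c \<beta> m = nat \<lfloor>c * real m powr (1 - \<beta>)\<rfloor>"

definition m0 :: "real \<Rightarrow> real \<Rightarrow> nat \<Rightarrow> nat" where
  "m0 c \<beta> m = m - m1 c \<beta> m"

text \<open>
  The law of \<open>(X\<^sub>1, \<dots>, X\<^sub>m)\<close> with set of true nulls \<open>H0\<close>; the \<open>X\<^sub>i\<close> are the coordinate maps.
\<close>

definition gauss_model :: "real \<Rightarrow> real \<Rightarrow> nat \<Rightarrow> nat set \<Rightarrow> (nat \<Rightarrow> real) measure" where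
  "gauss_model b \<beta> m H0 =
     (\<Pi>\<^sub>M i\<in>{1..m}. density lborel
        (\<lambda>x. ennreal (normal_density (if i \<in> H0 then 0 else mu b \<beta> m) 1 x)))"

definition null_set :: "real \<Rightarrow> real \<Rightarrow> nat \<Rightarrow> nat set \<Rightarrow> bool" where
  "null_set c \<beta> m H0 \<longleftrightarrow> H0 \<subseteq> {1..m} \<and> card H0 = m0 c \<beta> m"

definition ordered_pvalue :: "nat \<Rightarrow> (nat \<Rightarrow> real) \<Rightarrow> nat \<Rightarrow> real" where
  "ordered_pvalue m X k = sort (map (\<lambda>i. Phi_bar (X i)) [1..<Suc m]) ! (k - 1)"

definition bh_rejections :: "real \<Rightarrow> nat \<Rightarrow> (nat \<Rightarrow> real) \<Rightarrow> nat" where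
  "bh_rejections \<alpha> m X =
     Max (insert 0 {k\<in>{1..m}. real m * ordered_pvalue m X k / real k \<le> \<alpha>})"

definition G :: "real \<Rightarrow> real \<Rightarrow> real \<Rightarrow> nat \<Rightarrow> real \<Rightarrow> real" where
  "G b c \<beta> m t = (real (m0 c \<beta> m) / real m) * t
     + (real (m1 c \<beta> m) / real m) * Phi_bar (inv Phi_bar t - mu b \<beta> m)"

definition t_star :: "real \<Rightarrow> real \<Rightarrow> real \<Rightarrow> real \<Rightarrow> nat \<Rightarrow> real" where
  "t_star \<alpha> b c \<beta> m = (THE t. 0 < t \<and> t < 1 \<and> G b c \<beta> m t = 2 * t / \<alpha>)"

definition t_sharp :: "real \<Rightarrow> real \<Rightarrow> real \<Rightarrow> real \<Rightarrow> nat \<Rightarrow> real" where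
  "t_sharp \<alpha> b c \<beta> m = (THE t. 0 < t \<and> t < 1 \<and> G b c \<beta> m t = 0.5 * t / \<alpha>)"

lemma real_distribution_std_normal: "real_distribution std_normal_distribution"
  using prob_space_normal_density[of 1 0]
  by (simp add: real_distribution_def real_distribution_axioms_def)

lemma measure_std_normal_singleton: "measure std_normal_distribution {x} = 0"
proof -
  have "emeasure std_normal_distribution {x} = 0"
    by (subst emeasure_density) (auto simp: nn_integral_0_iff_AE intro!: AE_mp[OF AE_lborel_singleton[of x]])
  thus ?thesis by (simp add: measure_def)
qed

lemma Phi_bar_eq_cdf: "Phi_bar z = 1 - cdf std_normal_distribution z"
proof -
  interpret real_distribution std_normal_distribution by (rule real_distribution_std_normal)
  have "Phi_bar z = measure std_normal_distribution {z<..}"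
  proof -
    have "{z..} = {z} \<union> {z<..}" by auto
    hence "Phi_bar z = measure std_normal_distribution {z} + measure std_normal_distribution {z<..}"
      unfolding Phi_bar_def by (simp only:, subst finite_measure_Union) auto
    thus ?thesis by (simp add: measure_std_normal_singleton)
  qed
  also have "\<dots> = 1 - cdf std_normal_distribution z"
  proof -
    have "{z<..} = space std_normal_distribution - {..z}" by auto
    thus ?thesis unfolding cdf_def using prob_compl[of "{..z}"] by simp
  qed
  finally show ?thesis .
qed

lemma Phi_bar_strict: assumes "x < y" shows "Phi_bar y < Phi_bar x"
proof -
  interpret real_distribution std_normal_distribution by (rule real_distribution_std_normal)
  have "emeasure std_normal_distribution {x<..y} \<noteq> 0"
  proof
    assume "emeasure std_normal_distribution {x<..y} = 0"
    hence "AE z in lborel. ennreal (std_normal_density z) * indicator {x<..y} z = 0"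
      by (subst (asm) emeasure_density) (auto simp: nn_integral_0_iff_AE)
    hence "AE z in lborel. z \<notin> {x<..y}"
    proof eventually_elim
      case (elim z)
      have "\<not> std_normal_density z \<le> 0" using normal_density_pos[of 1 0 z] by linarith
      with elim show ?case by (auto simp: indicator_def ennreal_eq_0_iff split: if_splits)
    qed
    hence "emeasure lborel {x<..y} = 0"
      by (subst (asm) AE_iff_measurable[where N = "{x<..y}"]) auto
    thus False using assms by simp
  qed
  hence "measure std_normal_distribution {x<..y} > 0"
    by (simp add: emeasure_eq_measure zero_less_measure_iff)
  thus ?thesis using cdf_diff_eq[OF assms] by (simp add: Phi_bar_eq_cdf)
qed

lemma Phi_bar_surj: assumes "0 < t" "t < 1" shows "\<exists>z. Phi_bar z = t"
proof -
  interpret real_distribution std_normal_distribution by (rule real_distribution_std_normal)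
  have c: "\<forall>x. isCont (cdf std_normal_distribution) x"
    using isCont_cdf measure_std_normal_singleton by blast
  have "eventually (\<lambda>x. cdf std_normal_distribution x < 1 - t) at_bot"
    using order_tendstoD(2)[OF cdf_lim_at_bot] assms by simp
  then obtain x where x: "cdf std_normal_distribution x < 1 - t"
    using eventually_happens' trivial_limit_at_bot_linorder by blast
  have "eventually (\<lambda>y. 1 - t < cdf std_normal_distribution y) at_top"
    using order_tendstoD(1)[OF cdf_lim_at_top_prob] assms by simp
  then obtain y where y: "1 - t < cdf std_normal_distribution y"
    using eventually_happens' trivial_limit_at_top_linorder by blast
  have "x \<le> y" using x y cdf_nondecreasing[of y x] by linarith
  then obtain z where "cdf std_normal_distribution z = 1 - t"
    using IVT[of "cdf std_normal_distribution" x "1 - t" y] x y c by auto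
  thus ?thesis by (intro exI[of _ z]) (simp add: Phi_bar_eq_cdf)
qed

lemma m1_le: assumes "0 < c" "c < 1" "0 \<le> \<beta>" shows "m1 c \<beta> m \<le> m"
proof (cases "m = 0")
  case False
  have "real m powr (1 - \<beta>) \<le> real m powr 1" using False assms by (intro powr_mono) auto
  hence "c * real m powr (1 - \<beta>) \<le> 1 * real m" using False assms by (intro mult_mono) auto
  thus ?thesis unfolding m1_def by linarith
qed (simp add: m1_def)

text \<open>
  \<open>t_sharp\<close> only exists for \<open>\<alpha> < 1/2\<close>: \<open>G\<close> lies strictly above the diagonal.
\<close>

lemma G_greater_diagonal:
  assumes "0 < b" "0 < c" "c < 1" "0 \<le> \<beta>" "0 < m1 c \<beta> m" "0 < t" "t < 1"
  shows "t < G b c \<beta> m t"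
proof -
  have le: "m1 c \<beta> m \<le> m" using assms by (intro m1_le) auto
  hence m: "0 < m" using assms by linarith
  have "0 \<le> ln (real m)" using m by simp
  hence "0 < mu b \<beta> m" unfolding mu_def using assms by (intro add_nonneg_pos) auto
  hence "Phi_bar (inv Phi_bar t) < Phi_bar (inv Phi_bar t - mu b \<beta> m)"
    by (intro Phi_bar_strict) simp
  moreover have "Phi_bar (inv Phi_bar t) = t"
    using Phi_bar_surj[OF assms(6,7)] by (intro f_inv_into_f) auto
  ultimately have "(real (m1 c \<beta> m) / real m) * t
      < (real (m1 c \<beta> m) / real m) * Phi_bar (inv Phi_bar t - mu b \<beta> m)"
    using assms m by (intro mult_strict_left_mono) auto
  moreover have "(real (m0 c \<beta> m) / real m) * t + (real (m1 c \<beta> m) / real m) * t = t"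
    using le m by (simp add: m0_def of_nat_diff field_simps)
  ultimately show ?thesis unfolding G_def by linarith
qed

lemma no_t_sharp:
  assumes "0 < b" "0 < c" "c < 1" "0 \<le> \<beta>" "0 < m1 c \<beta> m" "1/2 \<le> \<alpha>"
  shows "\<nexists>t. 0 < t \<and> t < 1 \<and> G b c \<beta> m t = 0.5 * t / \<alpha>"
proof
  assume "\<exists>t. 0 < t \<and> t < 1 \<and> G b c \<beta> m t = 0.5 * t / \<alpha>"
  then obtain t where t: "0 < t" "t < 1" "G b c \<beta> m t = 0.5 * t / \<alpha>" by blast
  have "0.5 * t / \<alpha> \<le> t" using assms(6) t(1) by (simp add: field_simps)
  with G_greater_diagonal[OF assms(1-5) t(1,2)] t(3) show False by linarith
qed

text \<open>
  For \<open>\<beta> = 0\<close> the rate in the deviation bound cannot be chosen uniformly in \<open>c\<close>: then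
  \<open>t_star / c\<close> tends to \<open>0\<close> as \<open>c\<close> does (with \<open>m\<close> large), while fewer than \<open>t_star * m / \<alpha>\<close> rejections
  occur with probability at least of order \<open>exp (- C * m * s)\<close> where again \<open>s / c\<close> tends to \<open>0\<close>.
  For \<open>\<beta> > 0\<close> it can.
\<close>

end

theory Submission
  imports Defs
begin

text \<open>
  In the coordinate \<open>z = Phi_bar\<^sup>-\<^sup>1 t\<close> the slope \<open>G t / t\<close> is an affine function of the ratio
  \<open>R z = Phi_bar (z - \<mu>) / Phi_bar z\<close>. Exponential tilting (the likelihood ratio
  \<open>exp (\<mu> x - \<mu>\<^sup>2 / 2)\<close> of the two Gaussian laws is increasing in \<open>x\<close>) shows that \<open>R\<close> increases strictly
  from \<open>1\<close> to infinity and dominates \<open>exp (\<mu> z - \<mu>\<^sup>2 / 2)\<close>. So both defining equations have exactly one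
  solution. At \<open>t_star\<close> the ratio is at most of order \<open>m / m1\<close>; as \<open>exp (\<mu>\<^sup>2 / 2)\<close> is of larger order when
  \<open>\<beta> > 0\<close>, its quantile is eventually at most \<open>\<mu>\<close>, so that a fixed proportion of the alternatives lies
  below \<open>t_star\<close> and \<open>t_star\<close> is at least of order \<open>m1 / m\<close>.

  The number of p-values below \<open>t\<close> is a sum of independent indicators with mean \<open>m G t\<close>. The procedure stops
  below \<open>t_star\<close> only if this number is at most half its mean at \<open>t_star\<close>; it goes beyond \<open>t_sharp\<close>
  only if at some \<open>t = \<alpha> k / m > t_sharp\<close> it is at least \<open>k\<close>, which is at least twice its mean. Chernoff bounds and a
  geometric sum over \<open>k\<close> finish the argument.
\<close>

subsection \<open>Gaussian tails and the solutions of the slope equations\<close>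

abbreviation normal_law :: "real \<Rightarrow> real measure" where
  "normal_law a \<equiv> density lborel (\<lambda>x. ennreal (normal_density a 1 x))"

lemma Phi_bar_pos: "0 < Phi_bar z"
proof -
  have "0 \<le> Phi_bar (z + 1)" by (simp add: Phi_bar_def)
  thus ?thesis using Phi_bar_strict[of z "z + 1"] by simp
qed

lemma Phi_bar_less_1: "Phi_bar z < 1"
proof -
  interpret real_distribution std_normal_distribution by (rule real_distribution_std_normal)
  have "Phi_bar (z - 1) \<le> 1" by (simp add: Phi_bar_def)
  thus ?thesis using Phi_bar_strict[of "z - 1" z] by simp
qed

lemma Phi_bar_less_iff [simp]: "Phi_bar x < Phi_bar y \<longleftrightarrow> y < x"
  using Phi_bar_strict by (metis less_irrefl less_trans linorder_neqE)

lemma Phi_bar_le_iff [simp]: "Phi_bar x \<le> Phi_bar y \<longleftrightarrow> y \<le> x"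
  by (metis Phi_bar_less_iff not_less)

lemma Phi_bar_inv: "0 < t \<Longrightarrow> t < 1 \<Longrightarrow> Phi_bar (inv Phi_bar t) = t"
  using Phi_bar_surj by (intro f_inv_into_f) auto

lemma inv_Phi_bar [simp]: "inv Phi_bar (Phi_bar z) = z"
  by (rule inv_f_f) (metis Phi_bar_less_iff injI linorder_neqE order_less_irrefl)

lemma isCont_Phi_bar: "isCont Phi_bar z"
proof -
  interpret real_distribution std_normal_distribution by (rule real_distribution_std_normal)
  have "isCont (cdf std_normal_distribution) z"
    using isCont_cdf measure_std_normal_singleton by blast
  hence "isCont (\<lambda>z. 1 - cdf std_normal_distribution z) z" by (intro continuous_intros)
  moreover have "Phi_bar = (\<lambda>z. 1 - cdf std_normal_distribution z)"
    by (rule ext) (rule Phi_bar_eq_cdf)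
  ultimately show ?thesis by simp
qed

lemma Phi_bar_at_bot: "(Phi_bar \<longlongrightarrow> 1) at_bot"
proof -
  interpret real_distribution std_normal_distribution by (rule real_distribution_std_normal)
  have "((\<lambda>z. 1 - cdf std_normal_distribution z) \<longlongrightarrow> 1 - 0) at_bot"
    by (intro tendsto_intros cdf_lim_at_bot)
  moreover have "Phi_bar = (\<lambda>z. 1 - cdf std_normal_distribution z)"
    by (rule ext) (rule Phi_bar_eq_cdf)
  ultimately show ?thesis by simp
qed

section \<open>Gaussian location laws and exponential tilting\<close>

lemma measure_normal_law_atLeast: "measure (normal_law a) {z..} = Phi_bar (z - a)"
proof -
  have "emeasure (normal_law a) {z..}
      = (\<integral>\<^sup>+x. ennreal (normal_density a 1 x) * indicator {z..} x \<partial>lborel)"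
    by (subst emeasure_density) auto
  also have "\<dots> = (\<integral>\<^sup>+x. ennreal (normal_density a 1 (a + 1 * x)) * indicator {z..} (a + 1 * x) \<partial>lborel)"
    by (subst nn_integral_real_affine[of _ 1 a]) auto
  also have "\<dots> = (\<integral>\<^sup>+x. ennreal (std_normal_density x) * indicator {z - a..} x \<partial>lborel)"
    by (intro nn_integral_cong) (auto simp: normal_density_def indicator_def)
  also have "\<dots> = emeasure std_normal_distribution {z - a..}"
    by (subst emeasure_density) auto
  finally show ?thesis by (simp add: measure_def Phi_bar_def)
qed

lemma normal_density_tilt:
  "normal_density a 1 x = exp (a * x - a\<^sup>2 / 2) * std_normal_density x"
  by (simp add: normal_density_def flip: exp_add) (simp add: power2_eq_square field_simps)

text \<open>For \<open>a \<ge> 0\<close> the likelihood ratio increases in \<open>x\<close>, so on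
  \<open>S\<close> it is at least its value at the lower bound \<open>z\<close>; integrate this
  against the null law.\<close>

lemma measure_normal_law_ge:
  assumes "S \<in> sets borel" "0 \<le> a" "\<And>x. x \<in> S \<Longrightarrow> z \<le> x"
  shows "exp (a * z - a\<^sup>2 / 2) * measure (normal_law 0) S \<le> measure (normal_law a) S"
proof -
  interpret N: prob_space "normal_law a" by (rule prob_space_normal_density) simp
  interpret N0: prob_space "normal_law 0" by (rule prob_space_normal_density) simp
  have "ennreal (exp (a * z - a\<^sup>2 / 2)) * emeasure (normal_law 0) S
     = (\<integral>\<^sup>+x. ennreal (exp (a * z - a\<^sup>2 / 2)) * (ennreal (std_normal_density x) * indicator S x) \<partial>lborel)"
    using assms by (subst emeasure_density) (auto simp: nn_integral_cmult)
  also have "\<dots> \<le> (\<integral>\<^sup>+x. ennreal (normal_density a 1 x) * indicator S x \<partial>lborel)"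
    using assms
    by (intro nn_integral_mono)
       (auto simp: indicator_def normal_density_tilt[of a] simp flip: ennreal_mult
             intro!: ennreal_leI mult_right_mono mult_left_mono)
  also have "\<dots> = emeasure (normal_law a) S"
    using assms by (subst emeasure_density) auto
  finally show ?thesis
    by (simp add: N.emeasure_eq_measure N0.emeasure_eq_measure flip: ennreal_mult)
qed

lemma measure_normal_law_le:
  assumes "S \<in> sets borel" "0 \<le> a" "\<And>x. x \<in> S \<Longrightarrow> x \<le> z"
  shows "measure (normal_law a) S \<le> exp (a * z - a\<^sup>2 / 2) * measure (normal_law 0) S"
proof -
  interpret N: prob_space "normal_law a" by (rule prob_space_normal_density) simp
  interpret N0: prob_space "normal_law 0" by (rule prob_space_normal_density) simp
  have "emeasure (normal_law a) S = (\<integral>\<^sup>+x. ennreal (normal_density a 1 x) * indicator S x \<partial>lborel)"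
    using assms by (subst emeasure_density) auto
  also have "\<dots> \<le> (\<integral>\<^sup>+x. ennreal (exp (a * z - a\<^sup>2 / 2)) * (ennreal (std_normal_density x) * indicator S x) \<partial>lborel)"
    using assms
    by (intro nn_integral_mono)
       (auto simp: indicator_def normal_density_tilt[of a] simp flip: ennreal_mult
             intro!: ennreal_leI mult_right_mono mult_left_mono)
  also have "\<dots> = ennreal (exp (a * z - a\<^sup>2 / 2)) * emeasure (normal_law 0) S"
    using assms by (subst emeasure_density) (auto simp: nn_integral_cmult)
  finally show ?thesis
    by (simp add: N.emeasure_eq_measure N0.emeasure_eq_measure flip: ennreal_mult)
qed

section \<open>The ratio of shifted to unshifted Gaussian tails\<close>

definition tail_ratio :: "real \<Rightarrow> real \<Rightarrow> real" where
  "tail_ratio a z = Phi_bar (z - a) / Phi_bar z"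

lemma Phi_bar_shift_ge:
  "0 \<le> a \<Longrightarrow> exp (a * z - a\<^sup>2 / 2) * Phi_bar z \<le> Phi_bar (z - a)"
  using measure_normal_law_ge[of "{z..}" a z] by (simp add: measure_normal_law_atLeast)

lemma Phi_bar_shift_diff_le:
  assumes "0 \<le> a" "y \<le> z"
  shows "Phi_bar (y - a) - Phi_bar (z - a) \<le> exp (a * z - a\<^sup>2 / 2) * (Phi_bar y - Phi_bar z)"
proof -
  have diff: "measure (normal_law a') {y..<z} = Phi_bar (y - a') - Phi_bar (z - a')" for a'
  proof -
    interpret N: prob_space "normal_law a'" by (rule prob_space_normal_density) simp
    have "{y..<z} = {y..} - {z..}" by auto
    hence "measure (normal_law a') {y..<z} = measure (normal_law a') {y..} - measure (normal_law a') {z..}"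
      using assms(2) by (simp only:, intro N.finite_measure_Diff) auto
    thus ?thesis by (simp add: measure_normal_law_atLeast)
  qed
  show ?thesis
    using measure_normal_law_le[of "{y..<z}" a z] diff[of a] diff[of 0] assms by auto
qed

lemma Phi_bar_shift_diff_less:
  assumes "0 < a" "y < z"
  shows "Phi_bar (y - a) - Phi_bar (z - a) < exp (a * z - a\<^sup>2 / 2) * (Phi_bar y - Phi_bar z)"
proof -
  \<comment> \<open>Splitting at the midpoint yields strictness: on the left half the likelihood
    ratio is bounded by its value at \<open>w\<close>, which is strictly below its value at
    \<open>z\<close>.\<close>
  define w where "w = (y + z) / 2"
  have w: "y < w" "w < z" using assms by (auto simp: w_def)
  have "Phi_bar (y - a) - Phi_bar (w - a) \<le> exp (a * w - a\<^sup>2 / 2) * (Phi_bar y - Phi_bar w)"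
    using assms w by (intro Phi_bar_shift_diff_le) auto
  also have "\<dots> < exp (a * z - a\<^sup>2 / 2) * (Phi_bar y - Phi_bar w)"
    using assms w by (intro mult_strict_right_mono) auto
  finally have "Phi_bar (y - a) - Phi_bar (w - a) < exp (a * z - a\<^sup>2 / 2) * (Phi_bar y - Phi_bar w)" .
  moreover have "Phi_bar (w - a) - Phi_bar (z - a) \<le> exp (a * z - a\<^sup>2 / 2) * (Phi_bar w - Phi_bar z)"
    using assms w by (intro Phi_bar_shift_diff_le) auto
  ultimately show ?thesis by (simp add: algebra_simps)
qed

text \<open>With \<open>L\<close> the likelihood ratio at \<open>z\<close>, the shift multiplies the
  mass beyond \<open>z\<close> by at least \<open>L\<close> and the mass between \<open>y\<close>
  and \<open>z\<close> by less than \<open>L\<close>. Adjoining the second piece to the first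
  therefore lowers the quotient.\<close>

lemma tail_ratio_strict_mono:
  assumes "0 < a" "y < z"
  shows "tail_ratio a y < tail_ratio a z"
proof -
  define L where "L = exp (a * z - a\<^sup>2 / 2)"
  have "L * Phi_bar z \<le> Phi_bar (z - a)"
    using Phi_bar_shift_ge[of a z] assms by (simp add: L_def)
  hence "(L * Phi_bar z) * (Phi_bar y - Phi_bar z) \<le> Phi_bar (z - a) * (Phi_bar y - Phi_bar z)"
    using assms by (intro mult_right_mono) auto
  moreover have "(Phi_bar (y - a) - Phi_bar (z - a)) * Phi_bar z < (L * (Phi_bar y - Phi_bar z)) * Phi_bar z"
    using Phi_bar_shift_diff_less[OF assms] Phi_bar_pos by (intro mult_strict_right_mono) (auto simp: L_def)
  ultimately have "Phi_bar (y - a) * Phi_bar z < Phi_bar (z - a) * Phi_bar y"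
    by (simp add: algebra_simps)
  thus ?thesis
    using Phi_bar_pos[of y] Phi_bar_pos[of z] by (simp add: tail_ratio_def field_simps)
qed

lemma tail_ratio_ge: "0 \<le> a \<Longrightarrow> exp (a * z - a\<^sup>2 / 2) \<le> tail_ratio a z"
  using Phi_bar_shift_ge[of a z] Phi_bar_pos[of z] by (simp add: tail_ratio_def field_simps)

lemma tail_ratio_surj:
  assumes "0 < a" "1 < r"
  shows "\<exists>z. tail_ratio a z = r"
proof -
  have shift: "filterlim (\<lambda>z. z - a) at_bot at_bot"
    unfolding filterlim_at_bot eventually_at_bot_linorder
    by (metis add.commute diff_le_eq)
  have "((\<lambda>z. Phi_bar (z - a) / Phi_bar z) \<longlongrightarrow> 1 / 1) at_bot"
    by (intro tendsto_divide Phi_bar_at_bot filterlim_compose[OF Phi_bar_at_bot shift]) auto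
  hence "eventually (\<lambda>z. tail_ratio a z < r) at_bot"
    using assms unfolding tail_ratio_def by (auto dest: order_tendstoD(2))
  then obtain y where y: "tail_ratio a y < r"
    using eventually_happens' trivial_limit_at_bot_linorder by blast
  \<comment> \<open>Chosen so that the exponential lower bound \<open>tail_ratio_ge\<close> equals
    \<open>r\<close> at \<open>z\<close>.\<close>
  define z where "z = (ln r + a\<^sup>2 / 2) / a"
  have z: "r \<le> tail_ratio a z"
    using tail_ratio_ge[of a z] assms by (simp add: z_def)
  have "y \<le> z" using tail_ratio_strict_mono[of a z y] y z assms by fastforce
  moreover have "isCont (tail_ratio a) x" for x
    unfolding tail_ratio_def using Phi_bar_pos[of x]
    by (intro continuous_intros isCont_Phi_bar isCont_o2[OF _ isCont_Phi_bar]) auto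
  ultimately show ?thesis
    using IVT[of "tail_ratio a" y r z] y z by auto
qed

section \<open>Existence and uniqueness of the solutions\<close>

lemma G_eq_tail_ratio:
  assumes "0 < t" "t < 1"
  shows "G b c \<beta> m t = (real (m0 c \<beta> m) / real m
    + real (m1 c \<beta> m) / real m * tail_ratio (mu b \<beta> m) (inv Phi_bar t)) * t"
  using assms by (simp add: G_def tail_ratio_def Phi_bar_inv ring_distribs)

lemma mu_pos: "0 < b \<Longrightarrow> 0 \<le> \<beta> \<Longrightarrow> 0 < m \<Longrightarrow> 0 < mu b \<beta> m"
  unfolding mu_def by (intro add_nonneg_pos) auto

lemma inv_Phi_bar_less:
  assumes "0 < s" "s < t" "t < 1" shows "inv Phi_bar t < inv Phi_bar s"
  using assms Phi_bar_less_iff[of "inv Phi_bar s" "inv Phi_bar t"] by (simp add: Phi_bar_inv)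

lemma G_slope_strict_antimono:
  assumes "0 < b" "0 \<le> \<beta>" "0 < m" "0 < m1 c \<beta> m" "0 < s" "s < t" "t < 1"
  shows "G b c \<beta> m t / t < G b c \<beta> m s / s"
proof -
  have "tail_ratio (mu b \<beta> m) (inv Phi_bar t) < tail_ratio (mu b \<beta> m) (inv Phi_bar s)"
    using assms by (intro tail_ratio_strict_mono mu_pos inv_Phi_bar_less)
  thus ?thesis using assms by (simp add: G_eq_tail_ratio mult_strict_left_mono divide_strict_right_mono)
qed

lemma ex1_G_eq:
  assumes "0 < b" "0 < c" "c < 1" "0 \<le> \<beta>" "0 < m1 c \<beta> m" "1 < y"
  shows "\<exists>!t. 0 < t \<and> t < 1 \<and> G b c \<beta> m t = y * t"
proof -
  have le: "m1 c \<beta> m \<le> m" using assms by (intro m1_le) auto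
  hence m: "0 < m" using assms by linarith
  define p where "p = real (m1 c \<beta> m) / real m"
  have p: "0 < p" "real (m0 c \<beta> m) / real m = 1 - p"
    using assms m le by (auto simp: p_def m0_def of_nat_diff field_simps)
  \<comment> \<open>The value \<open>1 + (y - 1) / p\<close> solves the affine equation
    \<open>1 - p + p * r = y\<close> for the ratio \<open>r\<close>; it exceeds \<open>1\<close>,
    hence is attained, because \<open>y > 1\<close>.\<close>
  obtain z where z: "tail_ratio (mu b \<beta> m) z = 1 + (y - 1) / p"
    using tail_ratio_surj[of "mu b \<beta> m" "1 + (y - 1) / p"] mu_pos[of b \<beta> m] assms m p by auto
  show ?thesis
  proof (rule ex1I[of _ "Phi_bar z"])
    show "0 < Phi_bar z \<and> Phi_bar z < 1 \<and> G b c \<beta> m (Phi_bar z) = y * Phi_bar z"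
    proof -
      have "(1 - p) + p * (1 + (y - 1) / p) = y" using p by (simp add: field_simps)
      thus ?thesis by (simp add: Phi_bar_pos Phi_bar_less_1 G_eq_tail_ratio z p(2) flip: p_def)
    qed
    then have z': "G b c \<beta> m (Phi_bar z) / Phi_bar z = y" by auto
    fix t assume t: "0 < t \<and> t < 1 \<and> G b c \<beta> m t = y * t"
    hence "G b c \<beta> m t / t = y" by auto
    thus "t = Phi_bar z"
      using G_slope_strict_antimono[of b \<beta> m c t "Phi_bar z"] G_slope_strict_antimono[of b \<beta> m c "Phi_bar z" t]
        assms m t z' Phi_bar_pos[of z] Phi_bar_less_1[of z] by fastforce
  qed
qed

subsection \<open>Rejection counts\<close>

text \<open>In a sorted list the entries that are at most \<open>s\<close> form a prefix. Positions
  start at \<open>0\<close>, hence the strict inequality with the length of the prefix.\<close>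

lemma sorted_nth_le_iff:
  fixes s :: "'a :: linorder"
  assumes "sorted ys" "j < length ys"
  shows "ys ! j \<le> s \<longleftrightarrow> j < length (filter (\<lambda>y. y \<le> s) ys)"
  using assms
proof (induction ys arbitrary: j)
  case (Cons y ys)
  show ?case
  proof (cases "y \<le> s")
    case True
    then show ?thesis using Cons by (cases j) auto
  next
    case False
    hence *: "\<forall>x\<in>set (y # ys). \<not> x \<le> s" using Cons.prems(1) by auto
    hence "filter (\<lambda>y. y \<le> s) (y # ys) = []" by (simp only: filter_empty_conv)
    moreover have "\<not> (y # ys) ! j \<le> s" using * nth_mem[OF Cons.prems(2)] by blast
    ultimately show ?thesis by simp
  qed
qed simp

lemma length_filter_sort: "length (filter P (sort xs)) = length (filter P xs)"
  by (simp add: filter_sort)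

definition pvalue_count :: "nat \<Rightarrow> (nat \<Rightarrow> real) \<Rightarrow> real \<Rightarrow> nat" where
  "pvalue_count m X s = card {i \<in> {1..m}. Phi_bar (X i) \<le> s}"

lemma ordered_pvalue_le_iff:
  assumes "1 \<le> k" "k \<le> m"
  shows "ordered_pvalue m X k \<le> s \<longleftrightarrow> k \<le> pvalue_count m X s"
proof -
  have "ordered_pvalue m X k \<le> s
      \<longleftrightarrow> k - 1 < length (filter (\<lambda>y. y \<le> s) (map (\<lambda>i. Phi_bar (X i)) [1..<Suc m]))"
    unfolding ordered_pvalue_def using assms
    by (subst sorted_nth_le_iff) (auto simp: length_filter_sort simp del: upt_Suc)
  also have "length (filter (\<lambda>y. y \<le> s) (map (\<lambda>i. Phi_bar (X i)) [1..<Suc m]))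
      = card (set (filter (\<lambda>i. Phi_bar (X i) \<le> s) [1..<Suc m]))"
    by (subst distinct_card) (auto simp: filter_map o_def simp del: upt_Suc)
  also have "set (filter (\<lambda>i. Phi_bar (X i) \<le> s) [1..<Suc m]) = {i \<in> {1..m}. Phi_bar (X i) \<le> s}"
    by auto
  finally show ?thesis using assms by (auto simp: pvalue_count_def)
qed

text \<open>Duality between order statistics and counts: the step-up rule compares \<open>k\<close>
  with the number of p-values up to \<open>\<alpha> * k / m\<close>, which is a sum of independent
  indicators.\<close>

lemma bh_rejections_eq:
  "bh_rejections \<alpha> m X = Max (insert 0 {k \<in> {1..m}. k \<le> pvalue_count m X (\<alpha> * real k / real m)})"
proof -
  have "real m * ordered_pvalue m X k / real k \<le> \<alpha> \<longleftrightarrow> k \<le> pvalue_count m X (\<alpha> * real k / real m)"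
    if "k \<in> {1..m}" for k
  proof -
    have "real m * ordered_pvalue m X k / real k \<le> \<alpha> \<longleftrightarrow> ordered_pvalue m X k \<le> \<alpha> * real k / real m"
      using that by (simp add: field_simps)
    thus ?thesis using that by (simp add: ordered_pvalue_le_iff)
  qed
  hence "{k \<in> {1..m}. real m * ordered_pvalue m X k / real k \<le> \<alpha>}
      = {k \<in> {1..m}. k \<le> pvalue_count m X (\<alpha> * real k / real m)}"
    by blast
  thus ?thesis unfolding bh_rejections_def by simp
qed

lemma bh_rejections_ge:
  "1 \<le> k \<Longrightarrow> k \<le> m \<Longrightarrow> k \<le> pvalue_count m X (\<alpha> * real k / real m) \<Longrightarrow> k \<le> bh_rejections \<alpha> m X"
  unfolding bh_rejections_eq by (intro Max_ge) auto

lemma bh_rejections_cases: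
  "bh_rejections \<alpha> m X = 0 \<or>
    bh_rejections \<alpha> m X \<in> {k \<in> {1..m}. k \<le> pvalue_count m X (\<alpha> * real k / real m)}"
    (is "_ \<or> _ \<in> ?A")
proof -
  have "Max (insert 0 ?A) \<in> insert 0 ?A" by (rule Max_in) simp_all
  thus ?thesis unfolding bh_rejections_eq by blast
qed

lemma pvalue_count_le: "pvalue_count m X s \<le> m"
  unfolding pvalue_count_def by (rule order.trans[OF card_mono[of "{1..m}"]]) auto

lemma pvalue_count_mono: "s \<le> t \<Longrightarrow> pvalue_count m X s \<le> pvalue_count m X t"
  unfolding pvalue_count_def by (intro card_mono) auto

text \<open>Let \<open>k\<close> be the count at \<open>t\<close>. The hypothesis says that
  \<open>t\<close> is at most \<open>\<alpha> * k / m\<close>, so the count at the latter point is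
  still at least \<open>k\<close> and the procedure rejects at least \<open>k\<close> times.\<close>

lemma bh_rejections_lower:
  assumes "0 < \<alpha>" "0 < t" "0 < m" "real m * t / \<alpha> \<le> real (pvalue_count m X t)"
  shows "t \<le> \<alpha> * real (bh_rejections \<alpha> m X) / real m"
proof -
  define k where "k = pvalue_count m X t"
  have "0 < real m * t / \<alpha>" using assms by simp
  hence k: "0 < k" using assms(4) unfolding k_def by linarith
  have t: "t \<le> \<alpha> * real k / real m" using assms by (simp add: k_def field_simps)
  have "k \<le> bh_rejections \<alpha> m X"
    using k pvalue_count_le[of m X t] pvalue_count_mono[OF t, of m X]
    by (intro bh_rejections_ge) (auto simp: k_def)
  hence "\<alpha> * real k / real m \<le> \<alpha> * real (bh_rejections \<alpha> m X) / real m"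
    using assms by (intro divide_right_mono mult_left_mono) auto
  with t show ?thesis by linarith
qed

section \<open>Chernoff bounds for numbers of independent events\<close>

lemma prod_if_eq_power_card:
  "finite I \<Longrightarrow> (\<Prod>i\<in>I. if P i then u else (1 :: 'a :: comm_monoid_mult)) = u ^ card {i \<in> I. P i}"
  by (simp flip: prod.inter_filter)

text \<open>The marginal laws may differ from one coordinate to another, as nulls and alternatives
  do. They are probabilities at every index, also outside \<open>I\<close>, as
  \<open>product_prob_space\<close> asks.\<close>

locale product_count =
  fixes I :: "nat set" and M :: "nat \<Rightarrow> 'a measure" and S :: "nat \<Rightarrow> 'a set"
  assumes finite_I: "finite I" and prob_space_M: "\<And>i. prob_space (M i)"
    and sets_S [measurable]: "\<And>i. S i \<in> sets (M i)"
begin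

sublocale P: finite_product_prob_space M I
  using product_prob_spaceI[of M] prob_space_M finite_I
  by (simp add: finite_product_prob_space_def finite_product_sigma_finite_def
      finite_product_sigma_finite_axioms_def product_prob_space_def)

definition count :: "(nat \<Rightarrow> 'a) \<Rightarrow> nat" where "count x = card {i \<in> I. x i \<in> S i}"

definition mean :: real where "mean = (\<Sum>i\<in>I. measure (M i) (S i))"

lemma measurable_count [measurable]: "count \<in> measurable (PiM I M) (count_space UNIV)"
proof -
  have "{x \<in> space (PiM I M). j \<in> {i \<in> I. x i \<in> S i}} \<in> sets (PiM I M)" for j
    by (cases "j \<in> I") simp_all
  hence "(\<lambda>x. card {i \<in> I. x i \<in> S i}) \<in> measurable (PiM I M) (count_space UNIV)"
    by (rule measurable_card)
  thus ?thesis by (simp add: count_def[abs_def])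
qed

text \<open>By independence the expectation is a product of factors \<open>1 + (u - 1) * q\<close>
  with \<open>q\<close> the probability of one event, and each is at most
  \<open>exp ((u - 1) * q)\<close>. The bound is the generating function of a Poisson variable of
  the same mean.\<close>

lemma generating_function_le:
  assumes "0 < (u :: real)"
  shows "(\<integral>x. u ^ count x \<partial>PiM I M) \<le> exp ((u - 1) * mean)"
proof -
  have int: "integrable (M i) (\<lambda>x. if x \<in> S i then u else 1)" for i
    using assms by (intro P.M.integrable_const_bound[where B = "max u 1"]) auto
  have eq: "(\<integral>x. (if x \<in> S i then u else 1) \<partial>M i) = 1 + (u - 1) * measure (M i) (S i)" for i
  proof -
    have "(\<integral>x. (if x \<in> S i then u else 1) \<partial>M i) = (\<integral>x. 1 + (u - 1) * indicator (S i) x \<partial>M i)"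
      by (intro Bochner_Integration.integral_cong) (auto simp: indicator_def)
    also have "\<dots> = 1 + (u - 1) * measure (M i) (S i)"
      by (subst Bochner_Integration.integral_add)
         (auto simp: P.M.prob_space P.M.emeasure_eq_measure)
    finally show ?thesis .
  qed
  have "(\<integral>x. u ^ count x \<partial>PiM I M) = (\<integral>x. (\<Prod>i\<in>I. if x i \<in> S i then u else 1) \<partial>PiM I M)"
    using finite_I by (simp add: count_def prod_if_eq_power_card)
  also have "\<dots> = (\<Prod>i\<in>I. 1 + (u - 1) * measure (M i) (S i))"
    using finite_I int by (subst P.product_integral_prod) (auto simp: eq)
  also have "\<dots> \<le> (\<Prod>i\<in>I. exp ((u - 1) * measure (M i) (S i)))"
  proof (intro prod_mono conjI)
    fix i
    \<comment> \<open>The factor is \<open>(1 - q) + u * q\<close>, hence nonnegative even when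
      \<open>u < 1\<close>.\<close>
    have "0 \<le> u * measure (M i) (S i)" using assms by simp
    moreover have "measure (M i) (S i) \<le> 1" by simp
    ultimately show "0 \<le> 1 + (u - 1) * measure (M i) (S i)"
      unfolding left_diff_distrib by linarith
  qed (rule exp_ge_add_one_self)
  also have "\<dots> = exp ((u - 1) * mean)"
    using finite_I unfolding mean_def sum_distrib_left by (rule exp_sum[symmetric])
  finally show ?thesis .
qed

lemma markov_power:
  assumes "0 < (u :: real)" "0 < v"
  shows "measure (PiM I M) {x \<in> space (PiM I M). v \<le> u ^ count x} \<le> exp ((u - 1) * mean) / v"
proof -
  \<comment> \<open>A bound valid on both sides of \<open>u = 1\<close>; it makes the power of the
    count integrable.\<close>
  have "u ^ n \<le> max u 1 ^ card I" if "n \<le> card I" for n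
    using assms that by (intro order.trans[OF power_mono[of u "max u 1"] power_increasing]) auto
  moreover have "count x \<le> card I" for x
    unfolding count_def using finite_I by (intro card_mono) auto
  ultimately have "integrable (PiM I M) (\<lambda>x. u ^ count x)"
    using assms by (intro P.integrable_const_bound[where B = "max u 1 ^ card I"]) auto
  hence "measure (PiM I M) {x \<in> space (PiM I M). v \<le> u ^ count x} \<le> (\<integral>x. u ^ count x \<partial>PiM I M) / v"
    using assms by (intro integral_Markov_inequality_measure[where A = "{}"]) auto
  also have "\<dots> \<le> exp ((u - 1) * mean) / v"
    using assms generating_function_le by (intro divide_right_mono) auto
  finally show ?thesis .
qed

text \<open>The Markov bound at \<open>u = 1/2\<close> with
  \<open>v = (1/2) powr (mean / 2)\<close>: the exponent is
  \<open>- mean / 2 + ln 2 * mean / 2\<close>, negative for a positive mean as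
  \<open>ln 2 < 1\<close>.\<close>

lemma chernoff_lower:
  "measure (PiM I M) {x \<in> space (PiM I M). real (count x) \<le> mean / 2} \<le> exp (- ((1 - ln 2) / 2 * mean))"
proof -
  have "{x \<in> space (PiM I M). real (count x) \<le> mean / 2}
     \<subseteq> {x \<in> space (PiM I M). exp (- (ln 2 * mean / 2)) \<le> (1/2) ^ count x}"
  proof safe
    fix x assume "real (count x) \<le> mean / 2"
    hence "ln 2 * real (count x) \<le> ln 2 * (mean / 2)" by (intro mult_left_mono) auto
    hence "exp (- (ln 2 * mean / 2)) \<le> exp (- (ln 2 * real (count x)))" by simp
    also have "\<dots> = (1/2) ^ count x"
      by (simp add: exp_minus exp_of_nat2_mult power_one_over inverse_eq_divide)
    finally show "exp (- (ln 2 * mean / 2)) \<le> (1/2) ^ count x" .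
  qed
  hence "measure (PiM I M) {x \<in> space (PiM I M). real (count x) \<le> mean / 2}
      \<le> measure (PiM I M) {x \<in> space (PiM I M). exp (- (ln 2 * mean / 2)) \<le> (1/2) ^ count x}"
    by (intro P.finite_measure_mono) auto
  also have "\<dots> \<le> exp ((1/2 - 1) * mean) / exp (- (ln 2 * mean / 2))"
    by (intro markov_power) auto
  also have "\<dots> = exp (- ((1 - ln 2) / 2 * mean))"
    by (simp add: field_simps flip: exp_diff)
  finally show ?thesis .
qed

text \<open>The Markov bound at \<open>u = 2\<close> with \<open>v = 2 ^ k\<close>. The exponent
  \<open>mean - ln 2 * k\<close> is at most \<open>- (ln 2 - 1/2) * k\<close>, and
  \<open>ln 2 > 1/2\<close>.\<close>

lemma chernoff_upper:
  assumes "mean \<le> real k / 2"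
  shows "measure (PiM I M) {x \<in> space (PiM I M). k \<le> count x} \<le> exp (- ((ln 2 - 1/2) * real k))"
proof -
  have "{x \<in> space (PiM I M). k \<le> count x} = {x \<in> space (PiM I M). 2 ^ k \<le> (2 :: real) ^ count x}"
    by simp
  hence "measure (PiM I M) {x \<in> space (PiM I M). k \<le> count x} \<le> exp ((2 - 1) * mean) / 2 ^ k"
    by (simp only:) (intro markov_power, auto)
  also have "\<dots> = exp (mean - ln 2 * real k)"
    by (simp add: exp_diff exp_of_nat2_mult)
  also have "\<dots> \<le> exp (- ((ln 2 - 1/2) * real k))"
    using assms by (simp add: algebra_simps)
  finally show ?thesis .
qed

end

subsection \<open>Order of magnitude of the thresholds\<close>

text \<open>Two readings of the defining equation, obtained from \<open>m0 / m = 1 - p\<close>. The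
  first controls the quantile of a solution, the second compares the solution itself with
  \<open>p\<close>.\<close>

lemma G_solution:
  assumes "0 < c" "c < 1" "0 \<le> \<beta>" "0 < m" "0 < t" "t < 1" "G b c \<beta> m t = y * t"
  defines "p \<equiv> real (m1 c \<beta> m) / real m"
  shows "p * tail_ratio (mu b \<beta> m) (inv Phi_bar t) = y - 1 + p"
    and "p * Phi_bar (inv Phi_bar t - mu b \<beta> m) = (y - 1 + p) * t"
proof -
  have "m1 c \<beta> m \<le> m" using assms by (intro m1_le) auto
  hence "real (m0 c \<beta> m) / real m = 1 - p"
    using assms(4) by (simp add: p_def m0_def of_nat_diff diff_divide_distrib)
  hence "(1 - p + p * tail_ratio (mu b \<beta> m) (inv Phi_bar t)) * t = y * t"
    using assms(5-7) by (simp add: G_eq_tail_ratio p_def)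
  hence "1 - p + p * tail_ratio (mu b \<beta> m) (inv Phi_bar t) = y" using assms(5) by simp
  thus *: "p * tail_ratio (mu b \<beta> m) (inv Phi_bar t) = y - 1 + p" by linarith
  have "Phi_bar (inv Phi_bar t - mu b \<beta> m) = tail_ratio (mu b \<beta> m) (inv Phi_bar t) * t"
    using assms(5,6) by (simp add: tail_ratio_def Phi_bar_inv)
  thus "p * Phi_bar (inv Phi_bar t - mu b \<beta> m) = (y - 1 + p) * t"
    by (simp flip: *)
qed

text \<open>The expected proportion of alternatives below the threshold is at most \<open>1\<close>.
  This gives the upper bounds for both thresholds.\<close>

lemma G_solution_upper:
  assumes "0 < c" "c < 1" "0 \<le> \<beta>" "0 < m" "0 < t" "t < 1" "G b c \<beta> m t = y * t"
  shows "(y - 1) * t \<le> real (m1 c \<beta> m) / real m"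
proof -
  define p where "p = real (m1 c \<beta> m) / real m"
  have "p * Phi_bar (inv Phi_bar t - mu b \<beta> m) \<le> p * 1"
    by (intro mult_left_mono less_imp_le[OF Phi_bar_less_1]) (auto simp: p_def)
  moreover have "0 \<le> p * t" using assms by (simp add: p_def)
  ultimately show ?thesis
    using G_solution(2)[OF assms] by (simp add: p_def algebra_simps)
qed

lemma t_star_properties:
  assumes "0 < \<alpha>" "\<alpha> < 1" "0 < b" "0 < c" "c < 1" "0 \<le> \<beta>" "0 < m1 c \<beta> m"
  shows "\<exists>!t. 0 < t \<and> t < 1 \<and> G b c \<beta> m t = 2 * t / \<alpha>"
    and "0 < t_star \<alpha> b c \<beta> m" "t_star \<alpha> b c \<beta> m < 1"
    and "G b c \<beta> m (t_star \<alpha> b c \<beta> m) = 2 / \<alpha> * t_star \<alpha> b c \<beta> m"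
proof -
  show *: "\<exists>!t. 0 < t \<and> t < 1 \<and> G b c \<beta> m t = 2 * t / \<alpha>"
    using ex1_G_eq[of b c \<beta> m "2 / \<alpha>"] assms by simp
  show "0 < t_star \<alpha> b c \<beta> m" "t_star \<alpha> b c \<beta> m < 1"
    "G b c \<beta> m (t_star \<alpha> b c \<beta> m) = 2 / \<alpha> * t_star \<alpha> b c \<beta> m"
    using theI'[OF *] by (simp_all add: t_star_def)
qed

lemma t_sharp_properties:
  assumes "0 < \<alpha>" "\<alpha> < 1/2" "0 < b" "0 < c" "c < 1" "0 \<le> \<beta>" "0 < m1 c \<beta> m"
  shows "\<exists>!t. 0 < t \<and> t < 1 \<and> G b c \<beta> m t = 0.5 * t / \<alpha>"
    and "0 < t_sharp \<alpha> b c \<beta> m" "t_sharp \<alpha> b c \<beta> m < 1"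
    and "G b c \<beta> m (t_sharp \<alpha> b c \<beta> m) = 1 / (2 * \<alpha>) * t_sharp \<alpha> b c \<beta> m"
proof -
  show *: "\<exists>!t. 0 < t \<and> t < 1 \<and> G b c \<beta> m t = 0.5 * t / \<alpha>"
    using ex1_G_eq[of b c \<beta> m "0.5 / \<alpha>"] assms by simp
  show "0 < t_sharp \<alpha> b c \<beta> m" "t_sharp \<alpha> b c \<beta> m < 1"
    "G b c \<beta> m (t_sharp \<alpha> b c \<beta> m) = 1 / (2 * \<alpha>) * t_sharp \<alpha> b c \<beta> m"
    using theI'[OF *] by (simp_all add: t_sharp_def)
qed

text \<open>The slope \<open>G t / t\<close> is \<open>2 / \<alpha>\<close> at \<open>t_star\<close>
  and only \<open>1 / (2 * \<alpha>)\<close> at \<open>t_sharp\<close>, and it decreases in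
  \<open>t\<close>.\<close>

lemma t_star_le_t_sharp:
  assumes "0 < \<alpha>" "\<alpha> < 1/2" "0 < b" "0 < c" "c < 1" "0 \<le> \<beta>" "0 < m1 c \<beta> m"
  shows "t_star \<alpha> b c \<beta> m \<le> t_sharp \<alpha> b c \<beta> m"
proof (rule ccontr)
  assume less: "\<not> ?thesis"
  have m: "0 < m" using m1_le[of c \<beta> m] assms by auto
  have \<alpha>: "\<alpha> < 1" using assms by simp
  note star = t_star_properties[OF assms(1) \<alpha> assms(3-7)]
  note sharp = t_sharp_properties[OF assms]
  have "2 / \<alpha> < 1 / (2 * \<alpha>)"
    using G_slope_strict_antimono[of b \<beta> m c "t_sharp \<alpha> b c \<beta> m" "t_star \<alpha> b c \<beta> m"]
      less star sharp assms m by simp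
  thus False using assms by (simp add: field_simps)
qed

section \<open>Growth of the number of alternatives and lower bound for
  \<open>t_star\<close>\<close>

lemma m1_asymp:
  assumes "0 < c" "\<beta> < 1"
  shows "filterlim (\<lambda>m. real (m1 c \<beta> m)) at_top sequentially"
    and "\<forall>\<^sub>F m in sequentially. c / 2 * real m powr (1 - \<beta>) \<le> real (m1 c \<beta> m)"
proof -
  have "filterlim (\<lambda>m. exp ((1 - \<beta>) * ln (real m))) at_top sequentially"
    using assms
    by (intro filterlim_compose[OF exp_at_top] filterlim_tendsto_pos_mult_at_top[OF tendsto_const]
        filterlim_compose[OF ln_at_top filterlim_real_sequentially]) auto
  moreover have "\<forall>\<^sub>F m in sequentially. exp ((1 - \<beta>) * ln (real m)) \<le> real m powr (1 - \<beta>)"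
    using eventually_gt_at_top[of 0] by eventually_elim (simp add: powr_def)
  ultimately have "filterlim (\<lambda>m. real m powr (1 - \<beta>)) at_top sequentially"
    by (rule filterlim_at_top_mono)
  hence lim: "filterlim (\<lambda>m. c / 2 * real m powr (1 - \<beta>)) at_top sequentially"
    using assms by (intro filterlim_tendsto_pos_mult_at_top[OF tendsto_const]) auto
  \<comment> \<open>Taking the floor loses less than \<open>1\<close>, which half of
    \<open>c * m powr (1 - \<beta>)\<close> eventually covers.\<close>
  hence "\<forall>\<^sub>F m in sequentially. 1 \<le> c / 2 * real m powr (1 - \<beta>)"
    unfolding filterlim_at_top by blast
  thus *: "\<forall>\<^sub>F m in sequentially. c / 2 * real m powr (1 - \<beta>) \<le> real (m1 c \<beta> m)"
    by eventually_elim (unfold m1_def, linarith)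
  show "filterlim (\<lambda>m. real (m1 c \<beta> m)) at_top sequentially"
    by (rule filterlim_at_top_mono[OF lim *])
qed

lemma m1_eventually_pos:
  assumes "0 < c" "\<beta> < 1"
  shows "\<forall>\<^sub>F m in sequentially. 0 < m1 c \<beta> m"
proof -
  have "\<forall>\<^sub>F m in sequentially. 1 \<le> real (m1 c \<beta> m)"
    using m1_asymp(1)[OF assms] unfolding filterlim_at_top by blast
  thus ?thesis by eventually_elim linarith
qed

lemma sparsity_ge:
  assumes "0 < c" "\<beta> < 1"
  shows "\<forall>\<^sub>F m in sequentially. c / 2 * real m powr (- \<beta>) \<le> real (m1 c \<beta> m) / real m"
  using m1_asymp(2)[OF assms] eventually_gt_at_top[of 0]
proof eventually_elim
  case (elim m)
  have "c / 2 * real m powr (- \<beta>) = c / 2 * real m powr (1 - \<beta>) / real m"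
    using elim by (simp add: powr_diff powr_minus field_simps)
  also have "\<dots> \<le> real (m1 c \<beta> m) / real m" using elim by (intro divide_right_mono) auto
  finally show ?case .
qed

text \<open>
  Eventual upper bound for the distance of the quantile of \<open>t_star\<close> from \<open>\<mu>\<close>. It is free of \<open>c\<close> if
  \<open>\<beta> > 0\<close>, which makes the rate uniform in \<open>c\<close>.
\<close>

definition z_excess :: "real \<Rightarrow> real \<Rightarrow> real \<Rightarrow> real \<Rightarrow> real" where
  "z_excess \<alpha> b c \<beta> = (if 0 < \<beta> then 0 else (ln (4 / (\<alpha> * c)) + b\<^sup>2 / 2) / b - b)"

text \<open>Expand the square of \<open>s + b\<close> with
  \<open>s = sqrt (2 * \<beta> * ln m)\<close> and drop the term in \<open>b\<close> alone. The
  first factor matches the sparsity; the second diverges if \<open>\<beta> > 0\<close>.\<close>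

lemma mu_square_ge:
  assumes "0 < b" "0 \<le> \<beta>" "0 < m"
  shows "real m powr \<beta> * exp (b * sqrt (2 * \<beta> * ln (real m))) \<le> exp ((mu b \<beta> m)\<^sup>2 / 2)"
proof -
  define s where "s = sqrt (2 * \<beta> * ln (real m))"
  have s: "s\<^sup>2 = 2 * \<beta> * ln (real m)" using assms by (simp add: s_def)
  have "real m powr \<beta> * exp (b * s) = exp (\<beta> * ln (real m) + b * s)"
    using assms by (simp add: powr_def exp_add)
  also have "\<beta> * ln (real m) + b * s = s\<^sup>2 / 2 + b * s" by (simp add: s)
  also have "exp \<dots> \<le> exp ((mu b \<beta> m)\<^sup>2 / 2)"
    by (simp add: mu_def power2_sum flip: s_def)
  finally show ?thesis by (simp add: s_def)
qed

text \<open>The tail ratio at \<open>t_star\<close> dominates the likelihood ratio, so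
  \<open>p * exp (\<mu> * z - \<mu>\<^sup>2 / 2)\<close> is at most \<open>2 / \<alpha>\<close>. For
  \<open>\<beta> > 0\<close> a quantile beyond \<open>\<mu>\<close> eventually violates this; for
  \<open>\<beta> = 0\<close> the inequality is solved for \<open>z\<close>.\<close>

lemma quantile_t_star_le:
  assumes "0 < \<alpha>" "\<alpha> < 1" "0 < b" "0 < c" "c < 1" "0 \<le> \<beta>" "\<beta> < 1"
  shows "\<forall>\<^sub>F m in sequentially.
    inv Phi_bar (t_star \<alpha> b c \<beta> m) - mu b \<beta> m \<le> z_excess \<alpha> b c \<beta>"
proof -
  define z where "z m = inv Phi_bar (t_star \<alpha> b c \<beta> m)" for m
  define p where "p m = real (m1 c \<beta> m) / real m" for m
  have ratio: "\<forall>\<^sub>F m in sequentially. p m * exp (mu b \<beta> m * z m - (mu b \<beta> m)\<^sup>2 / 2) \<le> 2 / \<alpha>"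
    using m1_eventually_pos[OF assms(4,7)] eventually_gt_at_top[of 0]
  proof eventually_elim
    case (elim m)
    note star = t_star_properties[OF assms(1-6) elim(1)]
    have "p m \<le> 1" using m1_le[of c \<beta> m] assms elim by (simp add: p_def)
    have "p m * exp (mu b \<beta> m * z m - (mu b \<beta> m)\<^sup>2 / 2) \<le> p m * tail_ratio (mu b \<beta> m) (z m)"
      using mu_pos[of b \<beta> m] assms elim by (intro mult_left_mono tail_ratio_ge) (auto simp: p_def)
    also have "\<dots> = 2 / \<alpha> - 1 + p m"
      using G_solution(1)[OF assms(4-6) elim(2) star(2-4)] by (simp add: z_def p_def)
    finally show ?case using \<open>p m \<le> 1\<close> by linarith
  qed
  show ?thesis
  proof (cases "0 < \<beta>")
    case True
    have "filterlim (\<lambda>m. 2 * \<beta> * ln (real m)) at_top sequentially"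
      using True
      by (intro filterlim_tendsto_pos_mult_at_top[OF tendsto_const]
          filterlim_compose[OF ln_at_top filterlim_real_sequentially]) auto
    hence "filterlim (\<lambda>m. sqrt (2 * \<beta> * ln (real m))) at_top sequentially"
      by (rule filterlim_compose[OF sqrt_at_top])
    hence "filterlim (\<lambda>m. b * sqrt (2 * \<beta> * ln (real m))) at_top sequentially"
      using assms by (intro filterlim_tendsto_pos_mult_at_top[OF tendsto_const])
    hence "filterlim (\<lambda>m. exp (b * sqrt (2 * \<beta> * ln (real m)))) at_top sequentially"
      by (rule filterlim_compose[OF exp_at_top])
    hence "filterlim (\<lambda>m. c / 2 * exp (b * sqrt (2 * \<beta> * ln (real m)))) at_top sequentially"
      using assms by (intro filterlim_tendsto_pos_mult_at_top[OF tendsto_const]) auto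
    hence "\<forall>\<^sub>F m in sequentially. 2 / \<alpha> < c / 2 * exp (b * sqrt (2 * \<beta> * ln (real m)))"
      unfolding filterlim_at_top_dense by blast
    from this ratio sparsity_ge[OF assms(4,7)] eventually_gt_at_top[of 0] show ?thesis
    proof eventually_elim
      case (elim m)
      have "z m \<le> mu b \<beta> m"
      proof (rule ccontr)
        assume "\<not> z m \<le> mu b \<beta> m"
        hence "mu b \<beta> m * mu b \<beta> m \<le> mu b \<beta> m * z m"
          using mu_pos[of b \<beta> m] assms elim by (intro mult_left_mono) auto
        hence exp_le: "exp ((mu b \<beta> m)\<^sup>2 / 2) \<le> exp (mu b \<beta> m * z m - (mu b \<beta> m)\<^sup>2 / 2)"
          by (simp add: power2_eq_square)
        \<comment> \<open>The powers \<open>m powr (- \<beta>)\<close> from the sparsity and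
          \<open>m powr \<beta>\<close> from \<open>mu_square_ge\<close> cancel; the diverging
          factor remains.\<close>
        have "c / 2 * exp (b * sqrt (2 * \<beta> * ln (real m)))
            = (c / 2 * real m powr (- \<beta>)) * (real m powr \<beta> * exp (b * sqrt (2 * \<beta> * ln (real m))))"
          using elim by (simp add: powr_minus)
        also have "\<dots> \<le> p m * exp (mu b \<beta> m * z m - (mu b \<beta> m)\<^sup>2 / 2)"
          using elim order.trans[OF mu_square_ge exp_le] assms
          by (intro mult_mono) (auto simp: p_def)
        finally show False using elim by linarith
      qed
      thus ?case using True by (simp add: z_excess_def z_def)
    qed
  next
    case False
    hence \<beta>: "\<beta> = 0" using assms by simp
    from ratio sparsity_ge[OF assms(4,7)] eventually_gt_at_top[of 0] show ?thesis
    proof eventually_elim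
      case (elim m)
      have mu: "mu b \<beta> m = b" by (simp add: mu_def \<beta>)
      \<comment> \<open>For \<open>\<beta> = 0\<close> the power of \<open>m\<close> in
        \<open>sparsity_ge\<close> is \<open>1\<close>, so the proportion of alternatives is
        eventually at least \<open>c / 2\<close>.\<close>
      have "c / 2 * exp (b * z m - b\<^sup>2 / 2) \<le> p m * exp (b * z m - b\<^sup>2 / 2)"
        using elim by (intro mult_right_mono) (auto simp: \<beta> p_def)
      also have "\<dots> \<le> 2 / \<alpha>" using elim(1) by (simp add: mu)
      finally have "exp (b * z m - b\<^sup>2 / 2) \<le> 2 / \<alpha> / (c / 2)"
        using assms by (subst pos_le_divide_eq) (auto simp: mult.commute)
      also have "\<dots> = 4 / (\<alpha> * c)" by simp
      finally have "exp (b * z m - b\<^sup>2 / 2) \<le> 4 / (\<alpha> * c)" .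
      hence "b * z m - b\<^sup>2 / 2 \<le> ln (4 / (\<alpha> * c))"
        using assms by (subst ln_ge_iff) auto
      hence "z m \<le> (ln (4 / (\<alpha> * c)) + b\<^sup>2 / 2) / b"
        using assms by (simp add: field_simps)
      thus ?case using False by (simp add: z_excess_def z_def mu)
    qed
  qed
qed

text \<open>The constant in the lower bound for \<open>t_star\<close>: the reciprocal of the slope
  \<open>2 / \<alpha>\<close> times a lower bound for the expected proportion of alternatives below
  \<open>t_star\<close>. It depends on \<open>c\<close> only through
  \<open>z_excess\<close>.\<close>

definition kappa :: "real \<Rightarrow> real \<Rightarrow> real \<Rightarrow> real \<Rightarrow> real" where
  "kappa \<alpha> b c \<beta> = \<alpha> / 2 * Phi_bar (z_excess \<alpha> b c \<beta>)"

lemma t_star_ge: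
  assumes "0 < \<alpha>" "\<alpha> < 1" "0 < b" "0 < c" "c < 1" "0 \<le> \<beta>" "\<beta> < 1"
  shows "\<forall>\<^sub>F m in sequentially. kappa \<alpha> b c \<beta> * (real (m1 c \<beta> m) / real m) \<le> t_star \<alpha> b c \<beta> m"
  using quantile_t_star_le[OF assms] m1_eventually_pos[OF assms(4,7)] eventually_gt_at_top[of 0]
proof eventually_elim
  case (elim m)
  note star = t_star_properties[OF assms(1-6) elim(2)]
  define p where "p = real (m1 c \<beta> m) / real m"
  have p: "0 \<le> p" "p \<le> 1" using m1_le[of c \<beta> m] assms elim by (auto simp: p_def)
  have "p * Phi_bar (z_excess \<alpha> b c \<beta>)
      \<le> p * Phi_bar (inv Phi_bar (t_star \<alpha> b c \<beta> m) - mu b \<beta> m)"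
    using elim p by (intro mult_left_mono) auto
  also have "\<dots> = (2 / \<alpha> - 1 + p) * t_star \<alpha> b c \<beta> m"
    using G_solution(2)[OF assms(4-6) elim(3) star(2-4)] by (simp add: p_def)
  also have "\<dots> \<le> 2 / \<alpha> * t_star \<alpha> b c \<beta> m"
    using p star(2) by (intro mult_right_mono) auto
  finally have "\<alpha> / 2 * (p * Phi_bar (z_excess \<alpha> b c \<beta>)) \<le> \<alpha> / 2 * (2 / \<alpha> * t_star \<alpha> b c \<beta> m)"
    using assms by (intro mult_left_mono) auto
  also have "\<dots> = t_star \<alpha> b c \<beta> m" using assms by simp
  finally show ?case by (simp add: kappa_def p_def mult_ac)
qed

subsection \<open>Deviation bounds\<close>

lemma gauss_model_eq:
  "gauss_model b \<beta> m H0 = PiM {1..m} (\<lambda>i. normal_law (if i \<in> H0 then 0 else mu b \<beta> m))"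
  by (simp add: gauss_model_def)

lemma prob_space_gauss_model: "prob_space (gauss_model b \<beta> m H0)"
  unfolding gauss_model_eq by (rule prob_space_PiM) (rule prob_space_normal_density, simp)

lemma Phi_bar_measurable [measurable]: "Phi_bar \<in> borel_measurable borel"
  by (rule borel_measurable_continuous_onI) (simp add: continuous_at_imp_continuous_on isCont_Phi_bar)

lemma gauss_model_component_measurable:
  assumes "i \<in> {1..m}"
  shows "(\<lambda>X. X i) \<in> borel_measurable (gauss_model b \<beta> m H0)"
proof -
  have "(\<lambda>X. X i) \<in> measurable (gauss_model b \<beta> m H0) (normal_law (if i \<in> H0 then 0 else mu b \<beta> m))"
    unfolding gauss_model_eq by (rule measurable_component_singleton[OF assms])
  also have "measurable (gauss_model b \<beta> m H0) (normal_law (if i \<in> H0 then 0 else mu b \<beta> m))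
      = borel_measurable (gauss_model b \<beta> m H0)"
    by (rule measurable_cong_sets) simp_all
  finally show ?thesis .
qed

lemma pvalue_count_measurable [measurable]:
  "(\<lambda>X. pvalue_count m X s) \<in> measurable (gauss_model b \<beta> m H0) (count_space UNIV)"
  unfolding pvalue_count_def
proof (rule measurable_card)
  fix i :: nat
  show "{X \<in> space (gauss_model b \<beta> m H0). i \<in> {i \<in> {1..m}. Phi_bar (X i) \<le> s}} \<in> sets (gauss_model b \<beta> m H0)"
  proof (cases "i \<in> {1..m}")
    case True
    have "(\<lambda>X. Phi_bar (X i)) \<in> borel_measurable (gauss_model b \<beta> m H0)"
      by (rule measurable_compose[OF gauss_model_component_measurable[OF True] Phi_bar_measurable])
    hence "{X \<in> space (gauss_model b \<beta> m H0). Phi_bar (X i) \<le> s} \<in> sets (gauss_model b \<beta> m H0)"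
      by (rule borel_measurable_le) (rule borel_measurable_const)
    thus ?thesis using True by simp
  next
    case False
    hence "{X \<in> space (gauss_model b \<beta> m H0). i \<in> {i \<in> {1..m}. Phi_bar (X i) \<le> s}} = {}" by blast
    thus ?thesis by (simp only: sets.empty_sets)
  qed
qed

lemma bh_rejections_measurable [measurable]:
  "bh_rejections \<alpha> m \<in> measurable (gauss_model b \<beta> m H0) (count_space UNIV)"
proof -
  \<comment> \<open>As a single comprehension the set fits
    \<open>measurable_Max_nat\<close>.\<close>
  have "insert 0 {k \<in> {1..m}. Q k} = {k. k = 0 \<or> k \<in> {1..m} \<and> Q k}" for Q :: "nat \<Rightarrow> bool" by auto
  hence "bh_rejections \<alpha> m =
      (\<lambda>X. Max {k. k = 0 \<or> k \<in> {1..m} \<and> k \<le> pvalue_count m X (\<alpha> * real k / real m)})"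
    by (intro ext) (simp only: bh_rejections_eq)
  moreover have "Measurable.pred (gauss_model b \<beta> m H0)
      (\<lambda>X. k = 0 \<or> k \<in> {1..m} \<and> k \<le> pvalue_count m X (\<alpha> * real k / real m))" for k
    by measurable
  ultimately show ?thesis by (simp only: measurable_Max_nat)
qed

text \<open>A p-value is at most \<open>t\<close> exactly when its observation is at least the
  quantile of \<open>t\<close>. A null contributes \<open>t\<close> to the mean, an alternative
  \<open>Phi_bar (inv Phi_bar t - mu b \<beta> m)\<close>; the total is
  \<open>m * G t\<close>.\<close>

lemma pvalue_product_count:
  assumes "0 < t" "t < 1"
  shows "product_count {1..m} (\<lambda>i. normal_law (if i \<in> H0 then 0 else mu b \<beta> m)) (\<lambda>i. {inv Phi_bar t..})"
    and "product_count.count {1..m} (\<lambda>i. {inv Phi_bar t..}) X = pvalue_count m X t"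
    and "null_set c \<beta> m H0 \<Longrightarrow> m1 c \<beta> m \<le> m \<Longrightarrow> 0 < m \<Longrightarrow>
      product_count.mean {1..m} (\<lambda>i. normal_law (if i \<in> H0 then 0 else mu b \<beta> m)) (\<lambda>i. {inv Phi_bar t..})
        = real m * G b c \<beta> m t"
proof -
  show pc: "product_count {1..m} (\<lambda>i. normal_law (if i \<in> H0 then 0 else mu b \<beta> m)) (\<lambda>i. {inv Phi_bar t..})"
    by (rule product_count.intro) (simp_all add: prob_space_normal_density)
  have "Phi_bar x \<le> t \<longleftrightarrow> inv Phi_bar t \<le> x" for x
    using Phi_bar_le_iff[of x "inv Phi_bar t"] assms by (simp add: Phi_bar_inv)
  thus "product_count.count {1..m} (\<lambda>i. {inv Phi_bar t..}) X = pvalue_count m X t"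
    using product_count.count_def[OF pc] by (simp add: pvalue_count_def)
  assume H0: "null_set c \<beta> m H0" and m: "m1 c \<beta> m \<le> m" "0 < m"
  hence sub: "H0 \<subseteq> {1..m}" and card: "card H0 = m0 c \<beta> m" by (auto simp: null_set_def)
  hence "finite H0" by (auto intro: finite_subset)
  have "card ({1..m} - H0) = m1 c \<beta> m"
    using sub card m \<open>finite H0\<close> by (simp add: card_Diff_subset m0_def)
  have "product_count.mean {1..m} (\<lambda>i. normal_law (if i \<in> H0 then 0 else mu b \<beta> m)) (\<lambda>i. {inv Phi_bar t..})
      = (\<Sum>i\<in>{1..m}. if i \<in> H0 then t else Phi_bar (inv Phi_bar t - mu b \<beta> m))"
    unfolding product_count.mean_def[OF pc]
    using assms by (intro sum.cong) (auto simp: measure_normal_law_atLeast Phi_bar_inv)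
  also have "\<dots> = (\<Sum>i\<in>H0. t) + (\<Sum>i\<in>{1..m} - H0. Phi_bar (inv Phi_bar t - mu b \<beta> m))"
    by (subst sum.subset_diff[OF sub]) (auto intro!: arg_cong2[where f = "(+)"] sum.cong)
  also have "\<dots> = real m * G b c \<beta> m t"
    using m card \<open>card ({1..m} - H0) = m1 c \<beta> m\<close> by (simp add: G_def field_simps)
  finally show "product_count.mean {1..m} (\<lambda>i. normal_law (if i \<in> H0 then 0 else mu b \<beta> m)) (\<lambda>i. {inv Phi_bar t..})
      = real m * G b c \<beta> m t" .
qed

section \<open>Deviations of the rejection number below \<open>t_star\<close> and above
  \<open>t_sharp\<close>\<close>

lemma prob_few_small_pvalues:
  assumes "0 < t" "t < 1" "null_set c \<beta> m H0" "m1 c \<beta> m \<le> m" "0 < m"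
  shows "measure (gauss_model b \<beta> m H0)
      {X \<in> space (gauss_model b \<beta> m H0). real (pvalue_count m X t) \<le> real m * G b c \<beta> m t / 2}
    \<le> exp (- ((1 - ln 2) / 2 * (real m * G b c \<beta> m t)))"
  using product_count.chernoff_lower[OF pvalue_product_count(1)[OF assms(1,2), of m H0 b \<beta>]]
  unfolding pvalue_product_count(2)[OF assms(1,2)] pvalue_product_count(3)[OF assms] gauss_model_eq .

lemma prob_many_small_pvalues:
  assumes "0 < t" "t < 1" "null_set c \<beta> m H0" "m1 c \<beta> m \<le> m" "0 < m"
    and "real m * G b c \<beta> m t \<le> real k / 2"
  shows "measure (gauss_model b \<beta> m H0)
      {X \<in> space (gauss_model b \<beta> m H0). k \<le> pvalue_count m X t} \<le> exp (- ((ln 2 - 1/2) * real k))"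
  using product_count.chernoff_upper[OF pvalue_product_count(1)[OF assms(1,2), of m H0 b \<beta>], of k] assms(6)
  unfolding pvalue_product_count(2)[OF assms(1,2)] pvalue_product_count(3)[OF assms(1-5)] gauss_model_eq
  by blast

text \<open>Since the slope at \<open>t_star\<close> is \<open>2 / \<alpha>\<close>, half the mean
  count there is \<open>m * t_star / \<alpha>\<close>, the threshold in
  \<open>bh_rejections_lower\<close>. The event thus forces a count of at most half its
  mean.\<close>

lemma prob_below_t_star:
  assumes "0 < \<alpha>" "\<alpha> < 1" "0 < b" "0 < c" "c < 1" "0 \<le> \<beta>" "0 < m1 c \<beta> m" "null_set c \<beta> m H0"
  shows "measure (gauss_model b \<beta> m H0) {X \<in> space (gauss_model b \<beta> m H0).
      \<not> t_star \<alpha> b c \<beta> m \<le> \<alpha> * real (bh_rejections \<alpha> m X) / real m}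
    \<le> exp (- ((1 - ln 2) * (real m * t_star \<alpha> b c \<beta> m / \<alpha>)))"
proof -
  interpret prob_space "gauss_model b \<beta> m H0" by (rule prob_space_gauss_model)
  have le: "m1 c \<beta> m \<le> m" using assms by (intro m1_le) auto
  hence m: "0 < m" using assms by linarith
  define t where "t = t_star \<alpha> b c \<beta> m"
  note star = t_star_properties[OF assms(1-7), folded t_def]
  have "real m * G b c \<beta> m t / 2 = real m * t / \<alpha>" by (simp add: star(4))
  hence "real (pvalue_count m X t) \<le> real m * G b c \<beta> m t / 2"
    if "\<not> t \<le> \<alpha> * real (bh_rejections \<alpha> m X) / real m" for X
    using bh_rejections_lower[OF assms(1) star(2) m, of X] that by linarith
  hence "prob {X \<in> space (gauss_model b \<beta> m H0). \<not> t \<le> \<alpha> * real (bh_rejections \<alpha> m X) / real m}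
      \<le> prob {X \<in> space (gauss_model b \<beta> m H0). real (pvalue_count m X t) \<le> real m * G b c \<beta> m t / 2}"
    by (intro finite_measure_mono) auto
  also have "\<dots> \<le> exp (- ((1 - ln 2) / 2 * (real m * G b c \<beta> m t)))"
    by (rule prob_few_small_pvalues[OF star(2,3) assms(8) le m])
  also have "\<dots> = exp (- ((1 - ln 2) * (real m * t / \<alpha>)))"
    by (simp add: star(4))
  finally show ?thesis by (simp add: t_def)
qed

text \<open>Half of each exponent gives the common factor \<open>exp (- (r / 2 * K))\<close>; the
  other half is summed as a full geometric series.\<close>

lemma sum_exp_tail_le:
  fixes r K :: real
  assumes "0 < r" "finite A" "\<And>k. k \<in> A \<Longrightarrow> K \<le> real k"
  shows "(\<Sum>k\<in>A. exp (- (r * real k))) \<le> exp (- (r / 2 * K)) / (1 - exp (- (r / 2)))"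
proof -
  have lt: "exp (- (r / 2)) < 1" using assms by simp
  have "(\<Sum>k\<in>A. exp (- (r * real k))) \<le> (\<Sum>k\<in>A. exp (- (r / 2 * K)) * exp (- (r / 2)) ^ k)"
  proof (rule sum_mono)
    fix k assume "k \<in> A"
    hence "r / 2 * K \<le> r / 2 * real k" using assms by (intro mult_left_mono) auto
    thus "exp (- (r * real k)) \<le> exp (- (r / 2 * K)) * exp (- (r / 2)) ^ k"
      by (simp add: mult_ac flip: exp_of_nat_mult exp_add)
  qed
  also have "\<dots> = exp (- (r / 2 * K)) * (\<Sum>k\<in>A. exp (- (r / 2)) ^ k)"
    by (simp add: sum_distrib_left)
  also have "\<dots> \<le> exp (- (r / 2 * K)) * (\<Sum>k. exp (- (r / 2)) ^ k)"
    using assms lt by (intro mult_left_mono sum_le_suminf summable_geometric) auto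
  also have "(\<Sum>k. exp (- (r / 2)) ^ k) = 1 / (1 - exp (- (r / 2)))"
    using lt by (intro suminf_geometric) auto
  finally show ?thesis by simp
qed

text \<open>
  The event is covered by the events that at least \<open>k\<close> p-values are below \<open>\<alpha> * k / m\<close>, with
  \<open>k > m * t_sharp / \<alpha>\<close>. Since \<open>G t / t\<close> decreases, at most \<open>k / 2\<close> such p-values are expected.
\<close>

lemma prob_above_t_sharp:
  assumes "0 < \<alpha>" "\<alpha> < 1/2" "0 < b" "0 < c" "c < 1" "0 \<le> \<beta>" "0 < m1 c \<beta> m" "null_set c \<beta> m H0"
  defines "r \<equiv> ln 2 - 1/2"
  shows "measure (gauss_model b \<beta> m H0) {X \<in> space (gauss_model b \<beta> m H0).
      \<not> \<alpha> * real (bh_rejections \<alpha> m X) / real m \<le> t_sharp \<alpha> b c \<beta> m}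
    \<le> exp (- (r / 2 * (real m * t_sharp \<alpha> b c \<beta> m / \<alpha>))) / (1 - exp (- (r / 2)))"
proof -
  interpret prob_space "gauss_model b \<beta> m H0" by (rule prob_space_gauss_model)
  have le: "m1 c \<beta> m \<le> m" using assms by (intro m1_le) auto
  hence m: "0 < m" using assms by linarith
  define t where "t = t_sharp \<alpha> b c \<beta> m"
  note sharp = t_sharp_properties[OF assms(1-7), folded t_def]
  define A where "A = {k \<in> {1..m}. t < \<alpha> * real k / real m}"
  define E where "E k = {X \<in> space (gauss_model b \<beta> m H0). k \<le> pvalue_count m X (\<alpha> * real k / real m)}" for k
  have "{X \<in> space (gauss_model b \<beta> m H0). \<not> \<alpha> * real (bh_rejections \<alpha> m X) / real m \<le> t} \<subseteq> (\<Union>k\<in>A. E k)"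
  proof safe
    fix X assume X: "X \<in> space (gauss_model b \<beta> m H0)"
      "\<not> \<alpha> * real (bh_rejections \<alpha> m X) / real m \<le> t"
    \<comment> \<open>Without rejections \<open>0\<close> would exceed the positive
      \<open>t\<close>. Hence the number of rejections itself meets the counting condition and
      serves as \<open>k\<close>.\<close>
    hence "bh_rejections \<alpha> m X \<noteq> 0" using sharp(2) by (intro notI) simp
    thus "X \<in> (\<Union>k\<in>A. E k)"
      using bh_rejections_cases[of \<alpha> m X] X
      by (intro UN_I[of "bh_rejections \<alpha> m X"]) (auto simp: A_def E_def)
  qed
  hence "prob {X \<in> space (gauss_model b \<beta> m H0). \<not> \<alpha> * real (bh_rejections \<alpha> m X) / real m \<le> t}
      \<le> prob (\<Union>k\<in>A. E k)"
    by (intro finite_measure_mono) (auto simp: A_def E_def)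
  also have "\<dots> \<le> (\<Sum>k\<in>A. prob (E k))"
    by (intro finite_measure_subadditive_finite) (auto simp: A_def E_def)
  also have "\<dots> \<le> (\<Sum>k\<in>A. exp (- (r * real k)))"
  proof (rule sum_mono)
    fix k assume k: "k \<in> A"
    define s where "s = \<alpha> * real k / real m"
    \<comment> \<open>As \<open>k \<le> m\<close>, the point \<open>s\<close> is at most
      \<open>\<alpha> < 1\<close>, so that the slope comparison applies.\<close>
    have "\<alpha> * real k \<le> \<alpha> * real m" using k assms by (intro mult_left_mono) (auto simp: A_def)
    hence "s \<le> \<alpha>" using m by (simp add: s_def field_simps)
    moreover have "t < s" using k by (simp add: s_def A_def)
    ultimately have s: "0 < s" "s < 1" "t < s" using assms(2) sharp(2) by linarith+
    have "G b c \<beta> m s / s < 1 / (2 * \<alpha>)"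
      using G_slope_strict_antimono[of b \<beta> m c t s] assms m s sharp by simp
    hence "G b c \<beta> m s < s / (2 * \<alpha>)" using s by (simp add: field_simps)
    also have "s / (2 * \<alpha>) = real k / 2 / real m" using assms by (simp add: s_def)
    finally have "real m * G b c \<beta> m s \<le> real k / 2" using m by (simp add: field_simps)
    thus "prob (E k) \<le> exp (- (r * real k))"
      using prob_many_small_pvalues[OF s(1,2) assms(8) le m] by (simp add: E_def s_def r_def)
  qed
  also have "\<dots> \<le> exp (- (r / 2 * (real m * t / \<alpha>))) / (1 - exp (- (r / 2)))"
  proof (rule sum_exp_tail_le)
    show "0 < r" using ln2_ge_two_thirds by (simp add: r_def)
    fix k assume "k \<in> A"
    thus "real m * t / \<alpha> \<le> real k" using m assms by (simp add: A_def field_simps)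
  qed (simp add: A_def)
  finally show ?thesis by (simp add: t_def)
qed

section \<open>Choice of the rate and combination of the bounds\<close>

lemma (in prob_space) prob_conj_ge:
  assumes "{x \<in> space M. P x} \<in> events" "{x \<in> space M. Q x} \<in> events"
  shows "1 - prob {x \<in> space M. \<not> P x} - prob {x \<in> space M. \<not> Q x} \<le> prob {x \<in> space M. P x \<and> Q x}"
proof -
  have [measurable]: "Measurable.pred M P" "Measurable.pred M Q" using assms by (auto simp: pred_def)
  have "1 - prob {x \<in> space M. P x \<and> Q x} = prob {x \<in> space M. \<not> (P x \<and> Q x)}"
    by (subst prob_neg) auto
  also have "{x \<in> space M. \<not> (P x \<and> Q x)} = {x \<in> space M. \<not> P x} \<union> {x \<in> space M. \<not> Q x}"
    by auto
  also have "prob \<dots> \<le> prob {x \<in> space M. \<not> P x} + prob {x \<in> space M. \<not> Q x}"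
    by (intro measure_Un_le) auto
  finally show ?thesis by linarith
qed

text \<open>The smaller of the rates of the two deviation bounds, halved. The spare half later
  absorbs the constant from the geometric sum.\<close>

definition rate_const :: real where
  "rate_const = min (1 - ln 2) ((ln 2 - 1/2) / 2) / 2"

lemma rate_const_pos: "0 < rate_const"
  using ln2_ge_two_thirds ln_2_less_1 by (simp add: rate_const_def)

lemma rate_const_le: "2 * rate_const \<le> 1 - ln 2" "2 * rate_const \<le> (ln 2 - 1/2) / 2"
  by (simp_all add: rate_const_def min_def)

lemma kappa_pos: "0 < \<alpha> \<Longrightarrow> 0 < kappa \<alpha> b c \<beta>"
  by (simp add: kappa_def Phi_bar_pos)

text \<open>As \<open>\<alpha> < 1\<close>, \<open>m * t / \<alpha>\<close> is at least
  \<open>m * t\<close>, hence at least \<open>kappa * m1\<close>. This brings both deviation bounds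
  to the same exponential, with twice the final rate.\<close>

lemma exp_rate_le:
  assumes "0 < \<alpha>" "\<alpha> < 1" "0 < m" "2 * rate_const \<le> q"
    and "kappa \<alpha> b c \<beta> * (real (m1 c \<beta> m) / real m) \<le> t"
  shows "exp (- (q * (real m * t / \<alpha>))) \<le> exp (- (2 * (rate_const * kappa \<alpha> b c \<beta> * real (m1 c \<beta> m))))"
proof -
  have k: "0 \<le> kappa \<alpha> b c \<beta>" using kappa_pos[OF assms(1), of b c \<beta>] by simp
  have t: "0 \<le> t" using k by (intro order.trans[OF _ assms(5)]) simp
  have "kappa \<alpha> b c \<beta> * real (m1 c \<beta> m) \<le> real m * t" using assms by (simp add: field_simps)
  also have "\<dots> \<le> real m * t / \<alpha>" 
    using assms t mult_left_le[of \<alpha> "real m * t"] by (simp add: pos_le_divide_eq)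
  finally have "2 * rate_const * (kappa \<alpha> b c \<beta> * real (m1 c \<beta> m)) \<le> q * (real m * t / \<alpha>)"
    using assms rate_const_pos k by (intro mult_mono) auto
  thus ?thesis by (simp add: mult_ac)
qed

text \<open>The lower deviation is treated for all \<open>\<alpha>\<close> in the unit interval, the
  two-sided bound for \<open>\<alpha> < 1/2\<close>, where \<open>t_sharp\<close> exists. The rate
  may vary with \<open>c\<close> only when \<open>\<beta> = 0\<close>, and one index works for all
  null sets at once.\<close>

theorem theorem12:
  fixes \<alpha> b \<beta> :: real
  assumes "0 < \<alpha>" "\<alpha> < 1" and "0 < b" and "0 \<le> \<beta>" "\<beta> < 1"
  shows "\<exists>d :: real \<Rightarrow> real.
    (\<forall>c\<in>{0<..<1}. 0 < d c) \<and>
    (0 < \<beta> \<longrightarrow> d constant_on {0<..<1}) \<and>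
    (\<forall>c\<in>{0<..<1}.
      (\<forall>\<^sub>F m in sequentially. \<exists>!t. 0 < t \<and> t < 1 \<and> G b c \<beta> m t = 2 * t / \<alpha>) \<and>
      lesssim (\<lambda>m. real (m1 c \<beta> m) / real m) (\<lambda>m. t_star \<alpha> b c \<beta> m) \<and>
      lesssim (\<lambda>m. t_star \<alpha> b c \<beta> m) (\<lambda>m. real (m1 c \<beta> m) / real m) \<and>
      (\<forall>\<^sub>F m in sequentially. \<forall>H0. null_set c \<beta> m H0 \<longrightarrow>
        measure (gauss_model b \<beta> m H0)
          {X \<in> space (gauss_model b \<beta> m H0).
             t_star \<alpha> b c \<beta> m \<le> \<alpha> * real (bh_rejections \<alpha> m X) / real m}
        \<ge> 1 - 2 * exp (- d c * real (m1 c \<beta> m))) \<and>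
      (\<alpha> < 1/2 \<longrightarrow>
        (\<forall>\<^sub>F m in sequentially. \<exists>!t. 0 < t \<and> t < 1 \<and> G b c \<beta> m t = 0.5 * t / \<alpha>) \<and>
        (\<forall>\<^sub>F m in sequentially. t_star \<alpha> b c \<beta> m \<le> t_sharp \<alpha> b c \<beta> m) \<and>
        lesssim (\<lambda>m. t_sharp \<alpha> b c \<beta> m) (\<lambda>m. real (m1 c \<beta> m) / real m) \<and>
        (\<forall>\<^sub>F m in sequentially. \<forall>H0. null_set c \<beta> m H0 \<longrightarrow>
          measure (gauss_model b \<beta> m H0)
            {X \<in> space (gauss_model b \<beta> m H0).
               t_star \<alpha> b c \<beta> m \<le> \<alpha> * real (bh_rejections \<alpha> m X) / real m \<and>
               \<alpha> * real (bh_rejections \<alpha> m X) / real m \<le> t_sharp \<alpha> b c \<beta> m}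
          \<ge> 1 - 2 * exp (- d c * real (m1 c \<beta> m)))))"
proof (intro exI[of _ "\<lambda>c. rate_const * kappa \<alpha> b c \<beta>"] conjI ballI impI)
  fix c :: real assume "c \<in> {0<..<1}"
  show "0 < rate_const * kappa \<alpha> b c \<beta>" using rate_const_pos kappa_pos assms by simp
next
  assume "0 < \<beta>"
  thus "(\<lambda>c. rate_const * kappa \<alpha> b c \<beta>) constant_on {0<..<1}"
    unfolding constant_on_def
    by (intro exI[of _ "rate_const * (\<alpha> / 2 * Phi_bar 0)"]) (simp add: kappa_def z_excess_def)
next
  fix c :: real assume "c \<in> {0<..<1}"
  hence c: "0 < c" "c < 1" by auto
  note star = t_star_properties[OF assms(1-3) c assms(4)]
  note pos = m1_eventually_pos[OF c(1) assms(5)]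
  note star_ge = t_star_ge[OF assms(1-3) c assms(4,5)]
  have m_pos: "0 < m" if "0 < m1 c \<beta> m" for m
    using m1_le[of c \<beta> m] that c assms by auto
  define d where "d = rate_const * kappa \<alpha> b c \<beta>"
  have d: "0 < d" using rate_const_pos kappa_pos assms by (simp add: d_def)
  show "\<forall>\<^sub>F m in sequentially. \<exists>!t. 0 < t \<and> t < 1 \<and> G b c \<beta> m t = 2 * t / \<alpha>"
    using pos by eventually_elim (rule star(1))
  show "lesssim (\<lambda>m. real (m1 c \<beta> m) / real m) (\<lambda>m. t_star \<alpha> b c \<beta> m)"
    unfolding lesssim_def
  proof (intro exI[of _ "1 / kappa \<alpha> b c \<beta>"] conjI)
    show "\<forall>\<^sub>F m in sequentially. real (m1 c \<beta> m) / real m \<le> 1 / kappa \<alpha> b c \<beta> * t_star \<alpha> b c \<beta> m"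
      using star_ge
    proof eventually_elim
      case (elim m)
      thus ?case using kappa_pos[OF assms(1), of b c \<beta>] by (simp add: pos_le_divide_eq mult.commute)
    qed
  qed (simp add: kappa_pos assms)
  show "lesssim (\<lambda>m. t_star \<alpha> b c \<beta> m) (\<lambda>m. real (m1 c \<beta> m) / real m)"
    unfolding lesssim_def
  proof (intro exI[of _ 1] conjI)
    show "\<forall>\<^sub>F m in sequentially. t_star \<alpha> b c \<beta> m \<le> 1 * (real (m1 c \<beta> m) / real m)"
      using pos
    proof eventually_elim
      case (elim m)
      \<comment> \<open>From \<open>\<alpha> < 1\<close> follows
        \<open>2 / \<alpha> - 1 \<ge> 1\<close>, so the constant \<open>1\<close> suffices.\<close>
      have "1 * t_star \<alpha> b c \<beta> m \<le> (2 / \<alpha> - 1) * t_star \<alpha> b c \<beta> m"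
        using star(2)[OF elim] assms by (intro mult_right_mono) (auto simp: pos_le_divide_eq)
      also have "\<dots> \<le> real (m1 c \<beta> m) / real m"
        using G_solution_upper[OF c assms(4) m_pos[OF elim] star(2-4)[OF elim]] .
      finally show ?case by simp
    qed
  qed simp
  have below: "measure (gauss_model b \<beta> m H0) {X \<in> space (gauss_model b \<beta> m H0).
        \<not> t_star \<alpha> b c \<beta> m \<le> \<alpha> * real (bh_rejections \<alpha> m X) / real m}
      \<le> exp (- (2 * (d * real (m1 c \<beta> m))))"
    if "0 < m1 c \<beta> m" "kappa \<alpha> b c \<beta> * (real (m1 c \<beta> m) / real m) \<le> t_star \<alpha> b c \<beta> m"
      "null_set c \<beta> m H0" for m H0
    using order.trans[OF prob_below_t_star[OF assms(1-3) c assms(4) that(1,3)]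
        exp_rate_le[OF assms(1,2) m_pos[OF that(1)] rate_const_le(1) that(2)]]
    by (simp only: d_def)
  show "\<forall>\<^sub>F m in sequentially. \<forall>H0. null_set c \<beta> m H0 \<longrightarrow>
      1 - 2 * exp (- (rate_const * kappa \<alpha> b c \<beta>) * real (m1 c \<beta> m))
      \<le> measure (gauss_model b \<beta> m H0) {X \<in> space (gauss_model b \<beta> m H0).
           t_star \<alpha> b c \<beta> m \<le> \<alpha> * real (bh_rejections \<alpha> m X) / real m}"
    using pos star_ge unfolding d_def[symmetric]
  proof (eventually_elim, intro allI impI)
    fix m H0
    assume m: "0 < m1 c \<beta> m" "kappa \<alpha> b c \<beta> * (real (m1 c \<beta> m) / real m) \<le> t_star \<alpha> b c \<beta> m"
      and H0: "null_set c \<beta> m H0"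
    interpret prob_space "gauss_model b \<beta> m H0" by (rule prob_space_gauss_model)
    let ?P = "\<lambda>X. t_star \<alpha> b c \<beta> m \<le> \<alpha> * real (bh_rejections \<alpha> m X) / real m"
    have "1 - prob {X \<in> space (gauss_model b \<beta> m H0). \<not> ?P X} = prob {X \<in> space (gauss_model b \<beta> m H0). ?P X}"
      by (subst prob_neg) auto
    moreover have "exp (- (2 * (d * real (m1 c \<beta> m)))) \<le> exp (- d * real (m1 c \<beta> m))"
      using d by simp
    moreover have "0 < exp (- d * real (m1 c \<beta> m))" by simp
    ultimately show "1 - 2 * exp (- d * real (m1 c \<beta> m)) \<le> prob {X \<in> space (gauss_model b \<beta> m H0). ?P X}"
      using below[OF m H0] by linarith
  qed
  assume \<alpha>: "\<alpha> < 1/2"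
  note sharp = t_sharp_properties[OF assms(1) \<alpha> assms(3) c assms(4)]
  note le = t_star_le_t_sharp[OF assms(1) \<alpha> assms(3) c assms(4)]
  show "\<forall>\<^sub>F m in sequentially. \<exists>!t. 0 < t \<and> t < 1 \<and> G b c \<beta> m t = 0.5 * t / \<alpha>"
    using pos by eventually_elim (rule sharp(1))
  show "\<forall>\<^sub>F m in sequentially. t_star \<alpha> b c \<beta> m \<le> t_sharp \<alpha> b c \<beta> m"
    using pos by eventually_elim (rule le)
  have y: "0 < 1 / (2 * \<alpha>) - 1" using \<alpha> assms by (simp add: field_simps)
  show "lesssim (\<lambda>m. t_sharp \<alpha> b c \<beta> m) (\<lambda>m. real (m1 c \<beta> m) / real m)"
    unfolding lesssim_def
  proof (intro exI[of _ "1 / (1 / (2 * \<alpha>) - 1)"] conjI)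
    show "\<forall>\<^sub>F m in sequentially. t_sharp \<alpha> b c \<beta> m \<le> 1 / (1 / (2 * \<alpha>) - 1) * (real (m1 c \<beta> m) / real m)"
      using pos
    proof eventually_elim
      case (elim m)
      have "t_sharp \<alpha> b c \<beta> m \<le> (real (m1 c \<beta> m) / real m) / (1 / (2 * \<alpha>) - 1)"
        using G_solution_upper[OF c assms(4) m_pos[OF elim] sharp(2-4)[OF elim]] y
        by (subst pos_le_divide_eq) (auto simp: mult.commute)
      thus ?case by (simp add: mult.commute)
    qed
  qed (use y in simp)
  \<comment> \<open>The sum of the geometric series in \<open>prob_above_t_sharp\<close>; it depends
    on neither \<open>m\<close> nor \<open>c\<close>.\<close>
  define C :: real where "C = 1 / (1 - exp (- ((ln 2 - 1/2) / 2)))"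
  have "0 < (ln 2 - 1/2 :: real) / 2" using ln2_ge_two_thirds by simp
  hence C: "0 \<le> C" by (simp add: C_def)
  have above: "measure (gauss_model b \<beta> m H0) {X \<in> space (gauss_model b \<beta> m H0).
        \<not> \<alpha> * real (bh_rejections \<alpha> m X) / real m \<le> t_sharp \<alpha> b c \<beta> m}
      \<le> C * exp (- (2 * (d * real (m1 c \<beta> m))))"
    if m: "0 < m1 c \<beta> m" "kappa \<alpha> b c \<beta> * (real (m1 c \<beta> m) / real m) \<le> t_star \<alpha> b c \<beta> m"
      and H0: "null_set c \<beta> m H0" for m H0
  proof -
    let ?E = "exp (- ((ln 2 - 1/2) / 2 * (real m * t_sharp \<alpha> b c \<beta> m / \<alpha>)))"
    have "measure (gauss_model b \<beta> m H0) {X \<in> space (gauss_model b \<beta> m H0).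
        \<not> \<alpha> * real (bh_rejections \<alpha> m X) / real m \<le> t_sharp \<alpha> b c \<beta> m} \<le> C * ?E"
      using prob_above_t_sharp[OF assms(1) \<alpha> assms(3) c assms(4) m(1) H0] by (simp add: C_def)
    also have "?E \<le> exp (- (2 * (d * real (m1 c \<beta> m))))"
      using exp_rate_le[OF assms(1,2) m_pos[OF m(1)] rate_const_le(2) order.trans[OF m(2) le[OF m(1)]]]
      by (simp only: d_def)
    finally show ?thesis using C by (simp add: mult_left_mono)
  qed
  have "filterlim (\<lambda>m. d * real (m1 c \<beta> m)) at_top sequentially"
    using d m1_asymp(1)[OF c(1) assms(5)] by (intro filterlim_tendsto_pos_mult_at_top[OF tendsto_const])
  hence "filterlim (\<lambda>m. exp (d * real (m1 c \<beta> m))) at_top sequentially"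
    by (rule filterlim_compose[OF exp_at_top])
  \<comment> \<open>From here on \<open>(1 + C) * exp (- 2 * d * m1)\<close> is at most
    \<open>2 * exp (- d * m1)\<close>: giving up half the rate reduces the constant to
    \<open>2\<close>.\<close>
  hence large: "\<forall>\<^sub>F m in sequentially. (1 + C) / 2 \<le> exp (d * real (m1 c \<beta> m))"
    unfolding filterlim_at_top by blast
  show "\<forall>\<^sub>F m in sequentially. \<forall>H0. null_set c \<beta> m H0 \<longrightarrow>
      1 - 2 * exp (- (rate_const * kappa \<alpha> b c \<beta>) * real (m1 c \<beta> m))
      \<le> measure (gauss_model b \<beta> m H0) {X \<in> space (gauss_model b \<beta> m H0).
           t_star \<alpha> b c \<beta> m \<le> \<alpha> * real (bh_rejections \<alpha> m X) / real m \<and>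
           \<alpha> * real (bh_rejections \<alpha> m X) / real m \<le> t_sharp \<alpha> b c \<beta> m}"
    using pos star_ge large unfolding d_def[symmetric]
  proof (eventually_elim, intro allI impI)
    fix m H0
    assume m: "0 < m1 c \<beta> m" "kappa \<alpha> b c \<beta> * (real (m1 c \<beta> m) / real m) \<le> t_star \<alpha> b c \<beta> m"
      and large: "(1 + C) / 2 \<le> exp (d * real (m1 c \<beta> m))" and H0: "null_set c \<beta> m H0"
    interpret prob_space "gauss_model b \<beta> m H0" by (rule prob_space_gauss_model)
    let ?P = "\<lambda>X. t_star \<alpha> b c \<beta> m \<le> \<alpha> * real (bh_rejections \<alpha> m X) / real m"
    let ?Q = "\<lambda>X. \<alpha> * real (bh_rejections \<alpha> m X) / real m \<le> t_sharp \<alpha> b c \<beta> m"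
    define e where "e = exp (- (2 * (d * real (m1 c \<beta> m))))"
    have "(1 + C) * e \<le> (2 * exp (d * real (m1 c \<beta> m))) * e"
      using large by (intro mult_right_mono) (auto simp: e_def)
    also have "\<dots> = 2 * exp (- d * real (m1 c \<beta> m))"
      by (simp add: e_def flip: exp_add)
    finally have "e + C * e \<le> 2 * exp (- d * real (m1 c \<beta> m))" by (simp add: algebra_simps)
    moreover have "1 - prob {X \<in> space (gauss_model b \<beta> m H0). \<not> ?P X}
        - prob {X \<in> space (gauss_model b \<beta> m H0). \<not> ?Q X}
        \<le> prob {X \<in> space (gauss_model b \<beta> m H0). ?P X \<and> ?Q X}"
      by (rule prob_conj_ge) measurable
    ultimately show "1 - 2 * exp (- d * real (m1 c \<beta> m))
        \<le> prob {X \<in> space (gauss_model b \<beta> m H0). ?P X \<and> ?Q X}"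
      using below[OF m H0] above[OF m H0] unfolding e_def by linarith
  qed
qed

end
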